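(* Let $n\ge 1$ and let $\Omega\subset\mathbb{C}^n$ be a bounded starlike circular domain containing the origin, whose Minkowski functional $\rho$ is of class $\mathcal{C}^1$ on $\mathbb{C}^n\setminus E$, where $E\subset\mathbb{C}^n$ is an exceptional set consisting of lower-dimensional manifolds. Let $f:\Omega\to\mathbb{C}$ be holomorphic with $f(0)=1$, and let $F:\Omega\to\mathbb{C}^n$ be defined by $F(z)=z f(z)$. If $F\in\mathcal{S}^*(\Omega)$ (that is, $F$ is a normalized starlike mapping on $\Omega$), then for every $z\in\Omega\setminus E$, $$\left|(A_2-A_4)\left(A_2^2-2A_3^2+A_2A_4\right)\right|\le 84,$$ where $$A_2=2\frac{\partial\rho(z)}{\partial z}\frac{D^2F(0)(z^2)}{2!\,\rho^2(z)},\qquad A_3=2\frac{\partial\rho(z)}{\partial z}\frac{D^3F(0)(z^3)}{3!\,\rho^3(z)},\qquad A_4=2\frac{\partial\rho(z)}{\partial z}\frac{D^4F(0)(z^4)}{4!\,\rho^4(z)}.$$ Moreover, the bound is sharp: for each such $\Omega$, the constant $84$ cannot be replaced by any smaller constant valid for all such $f$ and $z$.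
   Context: A bounded starlike circular domain $\Omega\subset\mathbb{C}^n$ is a bounded domain of the form $\Omega=\{z\in\mathbb{C}^n:\rho(z)<1\}$, where $\rho:\mathbb{C}^n\to\mathbb{R}$ is a (unique) continuous function, called the Minkowski functional of $\Omega$, satisfying $\rho(z)\ge 0$, $\rho(z)=0\iff z=0$, and $\rho(tz)=|t|\rho(z)$ for $t\in\mathbb{C}$, $z\in\mathbb{C}^n$. The set $E$ is a union of manifolds of lower dimension in $\mathbb{C}^n$ off which $\rho$ is $\mathcal{C}^1$ (in particular $0\in E$, since $\rho$ is not differentiable at $0$). $\frac{\partial\rho(z)}{\partial z}=\left(\frac{\partial\rho(z)}{\partial z_1},\dots,\frac{\partial\rho(z)}{\partial z_n}\right)$ is the row vector of Wirtinger derivatives $\frac{\partial}{\partial z_j}=\frac12\left(\frac{\partial}{\partial x_j}-i\frac{\partial}{\partial y_j}\right)$, $z_j=x_j+iy_j$; it multiplies column vectors in $\mathbb{C}^n$. For a holomorphic $F:\Omega\to\mathbb{C}^n$, $D^kF(0)$ is the $k$-th Fréchet derivative at $0$, a symmetric $k$-linear mapping, and $D^kF(0)(z^k)=D^kF(0)(z,\dots,z)$ ($k$ times), a column vector in $\mathbb{C}^n$. A holomorphic $F:\Omega\to\mathbb{C}^n$ is normalized if $F(0)=0$ and $DF(0)=I$. It is biholomorphic if its inverse exists and is holomorphic on the domain $F(\Omega)$. A biholomorphic mapping $F$ on $\Omega$ is starlike if $F(\Omega)$ is starlike with respect to the origin (i.e. $tw\in F(\Omega)$ for all $w\in F(\Omega)$,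 $t\in[0,1]$). $\mathcal{S}^*(\Omega)$ is the class of normalized starlike (biholomorphic) mappings on $\Omega$. *)

theory Defs
  imports "HOL-Analysis.Analysis"
begin

section \<open>Exceptional sets\<close>

definition C1_on :: "('a::real_normed_vector \<Rightarrow> 'b::real_normed_vector) \<Rightarrow> 'a set \<Rightarrow> bool" where
  "C1_on f S \<longleftrightarrow>
     (\<exists>f'. (\<forall>x\<in>S. (f has_derivative blinfun_apply (f' x)) (at x)) \<and> continuous_on S f')"

text \<open>An embedded real submanifold of class \<open>C\<^sup>1\<close>: near each of its points a diffeomorphism
  between open subsets of the ambient space flattens \<open>M\<close> onto a \<open>d\<close>-dimensional linear subspace.\<close>

definition C1_submanifold :: "nat \<Rightarrow> 'a::euclidean_space set \<Rightarrow> bool" where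
  "C1_submanifold d M \<longleftrightarrow>
     (\<forall>p\<in>M. \<exists>U (V :: 'a set) \<phi> \<psi> L. open U \<and> p \<in> U \<and> open V \<and> homeomorphism U V \<phi> \<psi> \<and>
        C1_on \<phi> U \<and> C1_on \<psi> V \<and> subspace L \<and> dim L = d \<and> \<phi> ` (M \<inter> U) = L \<inter> V)"

text \<open>Dimensions are real: in \<open>\<complex>\<^sup>n\<close>, of real dimension \<open>2n\<close>, real hypersurfaces are allowed
  (already the polydisc requires them).  Without countability every set would qualify, as a union
  of points.\<close>

definition exceptional_set :: "'a::euclidean_space set \<Rightarrow> bool" where
  "exceptional_set E \<longleftrightarrow>
     (\<exists>\<M>. countable \<M> \<and> (\<forall>M\<in>\<M>. \<exists>d<DIM('a). C1_submanifold d M) \<and> E = \<Union>\<M>)"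


section \<open>Bounded starlike circular domains\<close>

definition minkowski_functional_of ::
    "(complex ^ 'n \<Rightarrow> real) \<Rightarrow> (complex ^ 'n) set \<Rightarrow> bool" where
  "minkowski_functional_of \<rho> \<Omega> \<longleftrightarrow>
     continuous_on UNIV \<rho> \<and> (\<forall>z. 0 \<le> \<rho> z) \<and> (\<forall>z. \<rho> z = 0 \<longleftrightarrow> z = 0) \<and>
     (\<forall>t z. \<rho> (t *s z) = cmod t * \<rho> z) \<and> \<Omega> = {z. \<rho> z < 1}"

definition bounded_starlike_circular_domain :: "(complex ^ 'n) set \<Rightarrow> bool" where
  "bounded_starlike_circular_domain \<Omega> \<longleftrightarrow>
     bounded \<Omega> \<and> open \<Omega> \<and> connected \<Omega> \<and> \<Omega> \<noteq> {} \<and> (\<exists>\<rho>. minkowski_functional_of \<rho> \<Omega>)"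


section \<open>Holomorphic and starlike mappings in several variables\<close>

definition holomorphic_fun_on :: "(complex ^ 'n \<Rightarrow> complex) \<Rightarrow> (complex ^ 'n) set \<Rightarrow> bool" where
  "holomorphic_fun_on f S \<longleftrightarrow>
     open S \<and> (\<forall>z\<in>S. \<exists>f'. (f has_derivative f') (at z) \<and> (\<forall>c v. f' (c *s v) = c * f' v))"

definition holomorphic_map_on ::
    "(complex ^ 'n \<Rightarrow> complex ^ 'm) \<Rightarrow> (complex ^ 'n) set \<Rightarrow> bool" where
  "holomorphic_map_on F S \<longleftrightarrow>
     open S \<and> (\<forall>z\<in>S. \<exists>F'. (F has_derivative F') (at z) \<and> (\<forall>c v. F' (c *s v) = c *s F' v))"

definition biholomorphic_on :: "(complex ^ 'n \<Rightarrow> complex ^ 'n) \<Rightarrow> (complex ^ 'n) set \<Rightarrow> bool" where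
  "biholomorphic_on F \<Omega> \<longleftrightarrow>
     holomorphic_map_on F \<Omega> \<and> inj_on F \<Omega> \<and> open (F ` \<Omega>) \<and> connected (F ` \<Omega>) \<and>
     holomorphic_map_on (inv_into \<Omega> F) (F ` \<Omega>)"

definition normalized_map :: "(complex ^ 'n \<Rightarrow> complex ^ 'n) \<Rightarrow> bool" where
  "normalized_map F \<longleftrightarrow> F 0 = 0 \<and> (F has_derivative (\<lambda>v. v)) (at 0)"

definition starlike_wrt_origin :: "'a::real_vector set \<Rightarrow> bool" where
  "starlike_wrt_origin S \<longleftrightarrow> (\<forall>w\<in>S. \<forall>t\<in>{0..1::real}. t *\<^sub>R w \<in> S)"

definition normalized_starlike_maps :: "(complex ^ 'n) set \<Rightarrow> (complex ^ 'n \<Rightarrow> complex ^ 'n) set" where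
  "normalized_starlike_maps \<Omega> =
     {F. normalized_map F \<and> biholomorphic_on F \<Omega> \<and> starlike_wrt_origin (F ` \<Omega>)}"


section \<open>Derivatives and coefficients\<close>

text \<open>The Frechet derivative as an operator-valued map, so that it can be iterated.  For holomorphic
  maps the real derivative coincides with the complex one.\<close>

definition Frechet ::
    "('a::real_normed_vector \<Rightarrow> 'b::real_normed_vector) \<Rightarrow> 'a \<Rightarrow> 'a \<Rightarrow>\<^sub>L 'b" where
  "Frechet F x = Blinfun (frechet_derivative F (at x))"

definition D2_diag :: "('a::real_normed_vector \<Rightarrow> 'b::real_normed_vector) \<Rightarrow> 'a \<Rightarrow> 'a \<Rightarrow> 'b" where
  "D2_diag F x z = blinfun_apply (blinfun_apply (Frechet (Frechet F) x) z) z"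

definition D3_diag :: "('a::real_normed_vector \<Rightarrow> 'b::real_normed_vector) \<Rightarrow> 'a \<Rightarrow> 'a \<Rightarrow> 'b" where
  "D3_diag F x z =
     blinfun_apply (blinfun_apply (blinfun_apply (Frechet (Frechet (Frechet F)) x) z) z) z"

definition D4_diag :: "('a::real_normed_vector \<Rightarrow> 'b::real_normed_vector) \<Rightarrow> 'a \<Rightarrow> 'a \<Rightarrow> 'b" where
  "D4_diag F x z =
     blinfun_apply (blinfun_apply (blinfun_apply (blinfun_apply
       (Frechet (Frechet (Frechet (Frechet F))) x) z) z) z) z"

definition wirtinger_row :: "(complex ^ 'n \<Rightarrow> real) \<Rightarrow> complex ^ 'n \<Rightarrow> complex ^ 'n" where
  "wirtinger_row \<rho> z =
     (\<chi> j. (1/2) * (complex_of_real (deriv (\<lambda>t::real. \<rho> (z + t *\<^sub>R axis j 1)) 0)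
               - \<i> * complex_of_real (deriv (\<lambda>t::real. \<rho> (z + t *\<^sub>R axis j \<i>)) 0)))"

text \<open>Row vector times column vector: complex bilinear, unlike the real inner product
  of the type \<open>complex ^ 'n\<close>.\<close>

definition row_times_column :: "complex ^ 'n \<Rightarrow> complex ^ 'n \<Rightarrow> complex" where
  "row_times_column a v = (\<Sum>j\<in>UNIV. a $ j * v $ j)"

definition A2 :: "(complex ^ 'n \<Rightarrow> real) \<Rightarrow> (complex ^ 'n \<Rightarrow> complex ^ 'n) \<Rightarrow> complex ^ 'n \<Rightarrow> complex" where
  "A2 \<rho> F z = 2 * row_times_column (wirtinger_row \<rho> z) (D2_diag F 0 z)
                / (fact 2 * complex_of_real (\<rho> z) ^ 2)"

definition A3 :: "(complex ^ 'n \<Rightarrow> real) \<Rightarrow> (complex ^ 'n \<Rightarrow> complex ^ 'n) \<Rightarrow> complex ^ 'n \<Rightarrow> complex" where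
  "A3 \<rho> F z = 2 * row_times_column (wirtinger_row \<rho> z) (D3_diag F 0 z)
                / (fact 3 * complex_of_real (\<rho> z) ^ 3)"

definition A4 :: "(complex ^ 'n \<Rightarrow> real) \<Rightarrow> (complex ^ 'n \<Rightarrow> complex ^ 'n) \<Rightarrow> complex ^ 'n \<Rightarrow> complex" where
  "A4 \<rho> F z = 2 * row_times_column (wirtinger_row \<rho> z) (D4_diag F 0 z)
                / (fact 4 * complex_of_real (\<rho> z) ^ 4)"

end

theory Submission
  imports Defs "HOL-Complex_Analysis.Complex_Analysis"
begin

text \<open>For \<open>z \<noteq> 0\<close> let \<open>z\<^sub>0 = z / \<rho> z\<close>.  Restricting \<open>F\<close> to the disc \<open>\<zeta> \<mapsto> \<zeta> z\<^sub>0\<close> gives the starlike univalent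
  function \<open>h \<zeta> = \<zeta> f (\<zeta> z\<^sub>0)\<close>, and by Euler's identity for \<open>\<rho>\<close> the numbers \<open>A\<^sub>k\<close> are its Taylor
  coefficients.  The function \<open>\<zeta> h' / h\<close> has nonnegative real part; with \<open>c\<^sub>k\<close> its coefficients,
  \<open>A\<^sub>2\<^sup>2 - 2A\<^sub>3\<^sup>2 + A\<^sub>2A\<^sub>4 = c\<^sub>1\<^sup>2 - c\<^sub>1\<^sup>4/3 - c\<^sub>1\<^sup>2c\<^sub>2/6 - c\<^sub>2\<^sup>2/2 + c\<^sub>1(c\<^sub>3 - c\<^sub>1c\<^sub>2)/3\<close>,
  so \<open>\<bar>c\<^sub>k\<bar> \<le> 2\<close> and \<open>\<bar>c\<^sub>3 - c\<^sub>1c\<^sub>2\<bar> \<le> 2\<close> bound this by \<open>14\<close>, while \<open>\<bar>A\<^sub>2 - A\<^sub>4\<bar> \<le> 6\<close>.  The bound is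
  approached by \<open>f z = (1 - z\<^sub>j / r)\<^sup>-\<^sup>2\<close>, with \<open>r\<close> the maximum of \<open>\<bar>z\<^sub>j\<bar>\<close> on \<open>\<rho> \<le> 1\<close>, at points where
  \<open>z\<^sub>j / (r \<rho> z)\<close> is close to \<open>\<i>\<close>; they exist outside \<open>E\<close> because \<open>E\<close> is a null set.\<close>

unbundle no Formal_Power_Series.fps_syntax

section \<open>Starlike functions on the disc\<close>

text \<open>On the unit circle conjugation is inversion, so integrating \<open>p\<close> against the
  power \<open>k\<close> of the conjugate picks out the Taylor coefficient, while for
  \<open>k > 0\<close> the conjugate of \<open>p\<close> contributes nothing. As \<open>Re p\<close>
  is half the sum of \<open>p\<close> and its conjugate, half the coefficient remains; for
  \<open>k = 0\<close> the total mass is \<open>p 0 = 1\<close>.\<close>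

lemma caratheodory_moment:
  assumes p: "p holomorphic_on ball 0 1" and "p 0 = 1" and r: "0 < r" "r < 1"
  shows "((\<lambda>t. of_real (Re (p (of_real r * exp (2 * of_real pi * \<i> * of_real t)))) *
             cnj (exp (2 * of_real pi * \<i> * of_real t)) ^ k) has_integral
          (if k = 0 then 1 else (deriv ^^ k) p 0 / fact k * of_real r ^ k / 2)) {0..1}"
proof -
  define e where "e t = exp (2 * of_real pi * \<i> * of_real t)" for t :: real
  define P where "P k = (deriv ^^ k) p 0 / fact k" for k
  have e0: "e t \<noteq> 0" for t by (simp add: e_def)
  have ce: "cnj (e t) = inverse (e t)" for t
    by (simp add: e_def exp_cnj flip: exp_minus)
  have cp: "circlepath 0 r t = r * e t" for t
    by (simp add: circlepath e_def)
  have vd: "vector_derivative (circlepath 0 r) (at t) = 2 * pi * \<i> * r * e t" for t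
    by (simp add: vector_derivative_circlepath e_def)
  have "cball 0 r \<subseteq> ball (0::complex) 1" "ball 0 r \<subseteq> ball (0::complex) 1"
    using r by auto
  then have hol: "p holomorphic_on ball 0 r" "continuous_on (cball 0 r) p"
    using holomorphic_on_subset[OF p, of "ball 0 r"] r
      continuous_on_subset[OF holomorphic_on_imp_continuous_on[OF p], of "cball 0 r"]
    by auto
  \<comment> \<open>Cauchy's formula for higher derivatives; the factor
    \<open>r ^ k / (2 * pi * \<i>)\<close> undoes its normalization and the radius in the
    kernel.\<close>
  have A: "((\<lambda>t. p (r * e t) * cnj (e t) ^ k) has_integral P k * r ^ k) {0..1}" for k
  proof -
    have "((\<lambda>u. p u / (u - 0) ^ Suc k) has_contour_integral
             2 * pi * \<i> / fact k * (deriv ^^ k) p 0) (circlepath 0 r)"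
      by (rule Cauchy_has_contour_integral_higher_derivative_circlepath) (use hol r in auto)
    then have "((\<lambda>t. p (r * e t) / (r * e t) ^ Suc k * (2 * pi * \<i> * r * e t)) has_integral
             2 * pi * \<i> / fact k * (deriv ^^ k) p 0) {0..1}"
      by (simp add: has_contour_integral cp vd)
    then have "((\<lambda>t. r ^ k / (2 * pi * \<i>) * (p (r * e t) / (r * e t) ^ Suc k * (2 * pi * \<i> * r * e t))) has_integral
             r ^ k / (2 * pi * \<i>) * (2 * pi * \<i> / fact k * (deriv ^^ k) p 0)) {0..1}"
      by (rule has_integral_mult_right)
    moreover have "r ^ k / (2 * pi * \<i>) * (p (r * e t) / (r * e t) ^ Suc k * (2 * pi * \<i> * r * e t))
        = p (r * e t) * cnj (e t) ^ k" for t
      using e0[of t] r by (simp add: ce field_simps)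
    moreover have "r ^ k / (2 * pi * \<i>) * (2 * pi * \<i> / fact k * (deriv ^^ k) p 0) = P k * r ^ k"
      by (simp add: P_def field_simps)
    ultimately show ?thesis by simp
  qed
  \<comment> \<open>The integrand \<open>p u * u ^ k\<close> has no pole, so Cauchy's theorem gives
    0. The velocity of the circle supplies one more factor \<open>e t\<close>, whence the exponent
    \<open>Suc k\<close>.\<close>
  have B: "((\<lambda>t. cnj (p (r * e t)) * cnj (e t) ^ Suc k) has_integral 0) {0..1}" for k
  proof -
    have "((\<lambda>u. p u * u ^ k) has_contour_integral 0) (circlepath 0 r)"
      by (rule Cauchy_theorem_convex_simple[where S = "ball 0 1"])
        (use p r in \<open>auto intro!: holomorphic_intros simp: path_image_circlepath_nonneg\<close>)
    then have "((\<lambda>t. p (r * e t) * (r * e t) ^ k * (2 * pi * \<i> * r * e t)) has_integral 0) {0..1}"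
      by (simp add: has_contour_integral cp vd)
    then have "((\<lambda>t. 1 / (2 * pi * \<i> * r ^ Suc k) * (p (r * e t) * (r * e t) ^ k * (2 * pi * \<i> * r * e t)))
       has_integral 1 / (2 * pi * \<i> * r ^ Suc k) * 0) {0..1}"
      by (rule has_integral_mult_right)
    moreover have "1 / (2 * pi * \<i> * r ^ Suc k) * (p (r * e t) * (r * e t) ^ k * (2 * pi * \<i> * r * e t))
       = p (r * e t) * e t ^ Suc k" for t
      using r by (simp add: field_simps)
    ultimately have "((\<lambda>t. p (r * e t) * e t ^ Suc k) has_integral 0) {0..1}" by simp
    from has_integral_cnj[THEN iffD2, OF this] show ?thesis
      by (simp add: o_def)
  qed
  have *: "of_real (Re u) * v = (u * v + cnj u * v) / 2" for u v :: complex
    by (simp add: complex_eq_iff algebra_simps)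
  show ?thesis
  proof (cases k)
    case 0
    have "((\<lambda>t. Re (p (r * e t) * cnj (e t) ^ 0)) has_integral Re (P 0 * r ^ 0)) {0..1}"
      using has_integral_linear[OF A[of 0] bounded_linear_Re] by (simp add: o_def)
    then have "((\<lambda>t. complex_of_real (Re (p (r * e t)))) has_integral of_real 1) {0..1}"
      using has_integral_linear[OF _ bounded_linear_of_real] \<open>p 0 = 1\<close>
      by (force simp: P_def o_def)
    then show ?thesis using 0 by (simp add: e_def)
  next
    case (Suc j)
    have "((\<lambda>t. (p (r * e t) * cnj (e t) ^ k + cnj (p (r * e t)) * cnj (e t) ^ k) / 2) has_integral
       (P k * r ^ k + 0) / 2) {0..1}"
      using B[of j] A[of k] Suc by (intro has_integral_divide has_integral_add) simp_all
    then show ?thesis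
      unfolding e_def[symmetric] * using Suc by (simp add: P_def)
  qed
qed

text \<open>With expectations for the probability density \<open>Re (p (r e\<^sup>i\<^sup>t))\<close> and \<open>X = e\<^sup>-\<^sup>i\<^sup>t\<close>, the difference
  \<open>c\<^sub>3 - c\<^sub>1c\<^sub>2\<close> is \<open>2 r\<^sup>-\<^sup>3 E((X - 2 E X) X\<^sup>2)\<close>, and \<open>E \<bar>X - 2 E X\<bar>\<^sup>2 = 1\<close>.\<close>

lemma caratheodory_bounds_radius:
  assumes p: "p holomorphic_on ball 0 1" and p0: "p 0 = 1"
    and pos: "\<And>z. z \<in> ball 0 1 \<Longrightarrow> 0 \<le> Re (p z)"
    and r: "0 < r" "r < 1"
  defines "c \<equiv> \<lambda>k. (deriv ^^ k) p 0 / fact k"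
  shows "k > 0 \<Longrightarrow> cmod (c k) * r ^ k \<le> 2" and "cmod (c 3 - c 1 * c 2) * r ^ 3 \<le> 2"
proof -
  define X where "X t = cnj (exp (2 * of_real pi * \<i> * of_real t))" for t :: real
  define w where "w t = Re (p (of_real r * exp (2 * of_real pi * \<i> * of_real t)))" for t :: real
  define m where "m k = c k * of_real r ^ k / 2" for k
  have X1: "cmod (X t) = 1" for t
    by (simp add: X_def)
  have w0: "w t \<ge> 0" for t
    unfolding w_def using r by (intro pos) (simp add: norm_mult)
  have mom: "((\<lambda>t. of_real (w t) * X t ^ k) has_integral (if k = 0 then 1 else m k)) {0..1}" for k
    unfolding w_def X_def m_def c_def by (rule caratheodory_moment[OF p p0 r])
  have tot: "(w has_integral 1) {0..1}"
    using has_integral_linear[OF mom[of 0] bounded_linear_Re] by (simp add: o_def)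
  have bound: "cmod I \<le> J"
    if "(f has_integral I) {0..1}" "(g has_integral J) {0..1}" "\<And>t. cmod (f t) \<le> g t"
    for f :: "real \<Rightarrow> complex" and g I J
    using integral_norm_bound_integral[of f "{0..1}" g] that
    by (metis has_integral_integrable integral_unique)
  show "cmod (c k) * r ^ k \<le> 2" if "k > 0"
  proof -
    have "cmod (m k) \<le> 1"
      using that by (intro bound[OF _ tot, of "\<lambda>t. of_real (w t) * X t ^ k"])
        (use mom[of k] w0 X1 in \<open>auto simp: norm_mult norm_power\<close>)
    then show ?thesis using r by (simp add: m_def norm_mult norm_power norm_divide)
  qed
  have "((\<lambda>t. of_real (w t) * X t ^ 3 - 2 * m 1 * (of_real (w t) * X t ^ 2)) has_integral
     m 3 - 2 * m 1 * m 2) {0..1}"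
    using mom[of 3] mom[of 2] by (intro has_integral_diff has_integral_mult_right) simp_all
  moreover
  have "((\<lambda>t. Re (cnj (m 1) * (of_real (w t) * X t ^ 1))) has_integral Re (cnj (m 1) * m 1)) {0..1}"
    using has_integral_linear[OF has_integral_mult_right bounded_linear_Re, OF mom[of 1], of "cnj (m 1)"]
    by (simp add: o_def)
  then have "((\<lambda>t. (1 + 2 * cmod (m 1) ^ 2) * w t - 2 * Re (cnj (m 1) * (of_real (w t) * X t ^ 1)))
      has_integral (1 + 2 * cmod (m 1) ^ 2) * 1 - 2 * Re (cnj (m 1) * m 1)) {0..1}"
    by (intro has_integral_diff has_integral_mult_right tot)
  moreover
  have "cmod (of_real (w t) * X t ^ 3 - 2 * m 1 * (of_real (w t) * X t ^ 2))
     \<le> (1 + 2 * cmod (m 1) ^ 2) * w t - 2 * Re (cnj (m 1) * (of_real (w t) * X t ^ 1))" for t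
  proof -
    have "of_real (w t) * X t ^ 3 - 2 * m 1 * (of_real (w t) * X t ^ 2)
        = of_real (w t) * X t ^ 2 * (X t - 2 * m 1)"
      by (simp add: algebra_simps power2_eq_square power3_eq_cube)
    then have "cmod (of_real (w t) * X t ^ 3 - 2 * m 1 * (of_real (w t) * X t ^ 2))
        = w t * cmod (X t - 2 * m 1)"
      using w0 X1 by (simp add: norm_mult norm_power)
    \<comment> \<open>By \<open>2 * x \<le> 1 + x\<^sup>2\<close> the modulus is traded for its
      square, whose integral is known exactly from the moments of order 0 and 1.\<close>
    also have "\<dots> \<le> w t * ((1 + cmod (X t - 2 * m 1) ^ 2) / 2)"
      using sum_squares_bound[of 1 "cmod (X t - 2 * m 1)"] w0 by (intro mult_left_mono) auto
    also have "cmod (X t - 2 * m 1) ^ 2 = cmod (X t) ^ 2 + 4 * cmod (m 1) ^ 2 - 4 * Re (cnj (m 1) * X t)"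
      by (simp only: cmod_power2) (simp add: power2_eq_square algebra_simps)
    finally show ?thesis
      by (simp add: X1 algebra_simps)
  qed
  ultimately have "cmod (m 3 - 2 * m 1 * m 2) \<le> (1 + 2 * cmod (m 1) ^ 2) * 1 - 2 * Re (cnj (m 1) * m 1)"
    by (rule bound)
  also have "\<dots> = 1"
    by (simp only: cmod_power2) (simp add: power2_eq_square algebra_simps)
  also have "m 3 - 2 * m 1 * m 2 = (c 3 - c 1 * c 2) * of_real r ^ 3 / 2"
    by (simp add: m_def algebra_simps power2_eq_square power3_eq_cube)
  finally show "cmod (c 3 - c 1 * c 2) * r ^ 3 \<le> 2"
    using r by (simp add: norm_mult norm_power norm_divide)
qed

text \<open>Letting \<open>r\<close> tend to 1 removes the radius from the preceding estimates;
  \<open>p\<close> itself need not have boundary values.\<close>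

lemma le_of_mult_power_le:
  fixes a b :: real
  assumes "\<And>r. 0 < r \<Longrightarrow> r < 1 \<Longrightarrow> a * r ^ k \<le> b"
  shows "a \<le> b"
proof (rule tendsto_le[OF _ tendsto_const])
  show "((\<lambda>r. a * r ^ k) \<longlongrightarrow> a) (at_left (1::real))"
    by (auto intro!: tendsto_eq_intros)
  show "\<forall>\<^sub>F r in at_left (1::real). a * r ^ k \<le> b"
    using eventually_at_left_real[of 0 1] assms by (auto elim!: eventually_mono)
qed simp

lemma caratheodory_bounds:
  assumes "p holomorphic_on ball 0 1" "p 0 = 1" "\<And>z. z \<in> ball 0 1 \<Longrightarrow> 0 \<le> Re (p z)"
  defines "c \<equiv> \<lambda>k. (deriv ^^ k) p 0 / fact k"
  shows "k > 0 \<Longrightarrow> cmod (c k) \<le> 2" and "cmod (c 3 - c 1 * c 2) \<le> 2"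
  using caratheodory_bounds_radius[OF assms(1-3)] unfolding c_def
  by (blast intro: le_of_mult_power_le)+

section \<open>Univalent functions on the disc with starlike image\<close>

text \<open>Schwarz' lemma for the map \<open>z \<mapsto> h\<inverse> (t h z)\<close>.\<close>

lemma starlike_inverse_norm_le:
  assumes h: "h holomorphic_on ball 0 1" and inj: "inj_on h (ball 0 1)" and h0: "h 0 = 0"
    and star: "starlike_wrt_origin (h ` ball 0 1)"
    and z: "z \<in> ball 0 1" and t: "t \<in> {0..1::real}"
    and z': "z' \<in> ball 0 1" "h z' = of_real t * h z"
  shows "cmod z' \<le> cmod z"
proof -
  obtain g where g: "g holomorphic_on h ` ball 0 1" "\<And>z. z \<in> ball 0 1 \<Longrightarrow> g (h z) = z"
    using holomorphic_has_inverse[OF h open_ball inj] by metis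
  have sub: "of_real t * h u \<in> h ` ball 0 1" if "u \<in> ball 0 1" for u
    using star t that by (auto simp: starlike_wrt_origin_def scaleR_conv_of_real)
  define v where "v u = g (of_real t * h u)" for u
  have "v holomorphic_on ball 0 1"
    unfolding v_def
    by (rule holomorphic_on_compose_gen[OF _ g(1), unfolded o_def])
      (use sub h in \<open>auto intro!: holomorphic_intros\<close>)
  moreover have "v 0 = 0" using g(2)[of 0] h0 by (simp add: v_def)
  moreover have "cmod (v u) < 1" if "cmod u < 1" for u
    using sub[of u] g(2) that by (auto simp: v_def)
  ultimately have "cmod (v z) \<le> cmod z"
    using Schwarz_Lemma(1)[of v z] z by simp
  moreover have "v z = z'"
    using g(2)[OF z'(1)] z'(2) by (simp add: v_def)
  ultimately show ?thesis by simp
qed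

text \<open>Pulling the segment from \<open>h z\<close> towards 0 back to the disc gives a curve
  that starts at \<open>z\<close> and, by the Schwarz estimate, never leaves the disc of radius
  \<open>cmod z\<close>. Hence its initial velocity \<open>- h z / deriv h z\<close> has nonpositive
  inner product with \<open>z\<close>, which is the claim up to a positive factor.\<close>

lemma starlike_Re_nonneg:
  assumes h: "h holomorphic_on ball 0 1" and inj: "inj_on h (ball 0 1)" and h0: "h 0 = 0"
    and star: "starlike_wrt_origin (h ` ball 0 1)"
    and z: "z \<in> ball 0 1" "z \<noteq> 0"
  shows "0 \<le> Re (z * deriv h z / h z)"
proof -
  obtain g where g: "g holomorphic_on h ` ball 0 1" "\<And>z. z \<in> ball 0 1 \<Longrightarrow> g (h z) = z"
      "\<And>z. z \<in> ball 0 1 \<Longrightarrow> deriv h z * deriv g (h z) = 1"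
    using holomorphic_has_inverse[OF h open_ball inj] by metis
  have op: "open (h ` ball 0 1)"
    using open_mapping_thm3[OF h open_ball inj] .
  have dg: "(g has_field_derivative deriv g (h z)) (at (h z))"
    by (rule holomorphic_derivI[OF g(1) op imageI[OF z(1)]])
  have hz: "h z \<noteq> 0"
    using inj_on_eq_iff[OF inj z(1), of 0] z(2) h0 by simp
  \<comment> \<open>The velocity of the curve \<open>\<phi>\<close> at time 0;
    \<open>deriv g (h z)\<close> is the reciprocal of \<open>deriv h z\<close>.\<close>
  define D where "D = - (h z * deriv g (h z))"
  define \<phi> where "\<phi> s = g (of_real (1 - s) * h z)" for s :: real
  have \<phi>0: "\<phi> 0 = z" using g(2)[OF z(1)] by (simp add: \<phi>_def)
  have lin: "((\<lambda>s. (1 - s) * h z) has_field_derivative - h z) (at (of_real 0))"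
    by (auto intro!: derivative_eq_intros)
  have "((\<lambda>s. g ((1 - s) * h z)) has_field_derivative deriv g (h z) * - h z) (at (of_real 0))"
    using DERIV_chain2[OF _ lin, of g "deriv g (h z)"] dg by simp
  then have "(\<phi> has_vector_derivative D) (at 0)"
    using has_vector_derivative_real_field[of "\<lambda>s. g ((1 - s) * h z)" D 0]
    by (simp add: \<phi>_def[abs_def] D_def mult.commute)
  then have V: "(\<phi> has_derivative (\<lambda>x. x *\<^sub>R D)) (at 0)"
    by (simp add: has_vector_derivative_def)
  have N: "((\<lambda>s. \<phi> s \<bullet> \<phi> s) has_field_derivative 2 * (z \<bullet> D)) (at 0)"
    unfolding has_field_derivative_def
    by (rule has_derivative_eq_rhs[OF has_derivative_inner[OF V V]])
      (simp add: fun_eq_iff \<phi>0 inner_commute)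
  have le: "\<phi> s \<bullet> \<phi> s \<le> z \<bullet> z" if s: "s \<in> {0..1}" for s :: real
  proof -
    have "(1 - s) *\<^sub>R h z \<in> h ` ball 0 1"
      using star z s by (auto simp: starlike_wrt_origin_def)
    then obtain z' where z': "z' \<in> ball 0 1" "h z' = of_real (1 - s) * h z"
      by (auto simp: scaleR_conv_of_real)
    have "cmod z' \<le> cmod z"
      by (rule starlike_inverse_norm_le[OF h inj h0 star z(1) _ z']) (use s in auto)
    moreover have "\<phi> s = z'"
      unfolding \<phi>_def using g(2)[OF z'(1)] z'(2) by simp
    ultimately show ?thesis by (simp flip: norm_le)
  qed
  have "z \<bullet> D \<le> 0"
  proof (rule ccontr)
    assume "\<not> z \<bullet> D \<le> 0"
    then obtain d where d: "d > 0" "\<And>s. 0 < s \<Longrightarrow> s < d \<Longrightarrow> \<phi> 0 \<bullet> \<phi> 0 < \<phi> s \<bullet> \<phi> s"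
      using DERIV_pos_inc_right[OF N] by auto
    \<comment> \<open>The cap at 1 keeps \<open>s\<close> in the interval on which \<open>le\<close>
      holds.\<close>
    define s where "s = min (d/2) 1"
    have "s > 0" "s < d" "s \<le> 1" using d by (auto simp: s_def)
    then show False
      using d(2)[of s] le[of s] \<phi>0 by simp
  qed
  \<comment> \<open>Since \<open>z = q * y\<close>, the inner product of \<open>z\<close> and
    \<open>y\<close> is \<open>Re q\<close> times the squared modulus of \<open>y\<close>.\<close>
  define q y where "q = z * deriv h z / h z" and "y = h z * deriv g (h z)"
  have q: "z = q * y"
    using g(3)[OF z(1)] hz by (simp add: q_def y_def field_simps)
  have "0 \<le> z \<bullet> y"
    using \<open>z \<bullet> D \<le> 0\<close> by (simp add: D_def y_def)
  also have "z \<bullet> y = (q * y) \<bullet> y"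
    using q by simp
  also have "\<dots> = Re q * (cmod y)\<^sup>2"
    by (simp only: inner_complex_def cmod_power2) (simp add: power2_eq_square algebra_simps)
  finally have "0 \<le> Re q * (cmod y)\<^sup>2" .
  moreover have "y \<noteq> 0" using q z(2) by auto
  ultimately show ?thesis
    unfolding q_def[symmetric] by (simp add: zero_le_mult_iff)
qed

section \<open>The coefficient inequality\<close>

text \<open>The gain lies in grouping \<open>c3\<close> with \<open>c1 * c2\<close>: bounding the
  terms in \<open>c1 * c3\<close> and \<open>c1\<^sup>2 * c2\<close> separately would yield 50/3
  instead of 14 for the second factor.\<close>

lemma starlike_coefficient_algebra:
  fixes c1 c2 c3 :: complex
  assumes "cmod c1 \<le> 2" "cmod c2 \<le> 2" "cmod c3 \<le> 2" "cmod (c3 - c1 * c2) \<le> 2"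
  defines "a2 \<equiv> c1" and "a3 \<equiv> (c2 + c1\<^sup>2) / 2" and "a4 \<equiv> c3 / 3 + c1 * c2 / 2 + c1 ^ 3 / 6"
  shows "cmod ((a2 - a4) * (a2\<^sup>2 - 2 * a3\<^sup>2 + a2 * a4)) \<le> 84"
proof -
  have c: "cmod (c1 * c2) \<le> 2 * 2" "cmod (c1 ^ 2) \<le> 2 ^ 2" "cmod (c1 ^ 3) \<le> 2 ^ 3" "cmod (c1 ^ 4) \<le> 2 ^ 4"
      "cmod (c2 ^ 2) \<le> 2 ^ 2" "cmod (c1 * (c3 - c1 * c2)) \<le> 2 * 2"  "cmod (c1 ^ 2 * c2) \<le> 2 ^ 2 * 2"
    unfolding norm_mult norm_power using assms(1-4) by (intro mult_mono power_mono; simp)+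
  have "cmod (a2 - a4) \<le> cmod a2 + cmod a4" by (rule norm_triangle_ineq4)
  also have "cmod a4 \<le> cmod (c3 / 3) + cmod (c1 * c2 / 2) + cmod (c1 ^ 3 / 6)"
    unfolding a4_def by (metis norm_triangle_ineq norm_triangle_mono order_refl)
  also have "\<dots> \<le> 4" using c assms(3) by (simp add: norm_divide)
  finally have 1: "cmod (a2 - a4) \<le> 6" using assms(1) by (simp add: a2_def)
  have "a2\<^sup>2 - 2 * a3\<^sup>2 + a2 * a4
      = c1\<^sup>2 - c1 ^ 4 / 3 - c1\<^sup>2 * c2 / 6 - c2\<^sup>2 / 2 + c1 * (c3 - c1 * c2) / 3"
    unfolding a2_def a3_def a4_def by (simp add: field_simps power2_eq_square power3_eq_cube power4_eq_xxxx)
  also have "cmod \<dots> \<le> cmod (c1\<^sup>2) + cmod (c1 ^ 4 / 3) + cmod (c1\<^sup>2 * c2 / 6) + cmod (c2\<^sup>2 / 2)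
      + cmod (c1 * (c3 - c1 * c2) / 3)"
    by (intro order_trans[OF norm_triangle_ineq] order_trans[OF norm_triangle_ineq4] add_mono order_refl)
  \<comment> \<open>The five terms contribute 4, 16/3, 4/3, 2 and 4/3.\<close>
  also have "\<dots> \<le> 14" using c by (simp add: norm_divide)
  finally have "cmod (a2\<^sup>2 - 2 * a3\<^sup>2 + a2 * a4) \<le> 14" .
  with 1 have "cmod (a2 - a4) * cmod (a2\<^sup>2 - 2 * a3\<^sup>2 + a2 * a4) \<le> 6 * 14"
    by (intro mult_mono) auto
  then show ?thesis by (simp add: norm_mult)
qed

text \<open>The product is the determinant of the symmetric 3 by 3 Toeplitz matrix with first row
  \<open>a 2\<close>, \<open>a 3\<close>, \<open>a 4\<close>.\<close>

lemma starlike_toeplitz_bound: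
  assumes h: "h holomorphic_on ball 0 1" and inj: "inj_on h (ball 0 1)" and h0: "h 0 = 0"
    and h1: "deriv h 0 = 1" and star: "starlike_wrt_origin (h ` ball 0 1)"
  defines "a \<equiv> \<lambda>k. (deriv ^^ k) h 0 / fact k"
  shows "cmod ((a 2 - a 4) * ((a 2)\<^sup>2 - 2 * (a 3)\<^sup>2 + a 2 * a 4)) \<le> 84"
proof -
  obtain f where f: "f holomorphic_on ball 0 1" "\<And>z. cmod z < 1 \<Longrightarrow> h z = z * f z" "deriv h 0 = f 0"
    using Schwarz3[OF h h0] by metis
  have f0: "f z \<noteq> 0" if "z \<in> ball 0 1" for z
    using inj_on_eq_iff[OF inj that, of 0] h0 h1 f(2)[of z] f(3) that by auto
  \<comment> \<open>This is \<open>z * deriv h z / h z\<close> with the singularity at 0 removed.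
    The denominator has no zero: off 0 by injectivity of \<open>h\<close>, at 0 because
    \<open>f 0 = deriv h 0 = 1\<close>.\<close>
  define p where "p z = deriv h z / f z" for z
  have p: "p holomorphic_on ball 0 1"
    unfolding p_def using h f f0 by (auto intro!: holomorphic_intros)
  have p0: "p 0 = 1" using h1 f(3) by (simp add: p_def)
  have "0 \<le> Re (p z)" if "z \<in> ball 0 1" for z
  proof (cases "z = 0")
    case False
    then show ?thesis
      using starlike_Re_nonneg[OF h inj h0 star that] f(2)[of z] f0 that by (simp add: p_def)
  qed (simp add: p0)
  note cb = caratheodory_bounds[OF p p0 this]
  define c where "c k = (deriv ^^ k) p 0 / fact k" for k
  have c: "cmod (c 1) \<le> 2" "cmod (c 2) \<le> 2" "cmod (c 3) \<le> 2" "cmod (c 3 - c 1 * c 2) \<le> 2"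
    unfolding c_def by (rule cb; simp)+
  have an: "u analytic_on {0}" if "u holomorphic_on ball 0 1" for u
    using that analytic_at_ball zero_less_one by blast
  define H F P where "H = fps_expansion h 0" and "F = fps_expansion f 0" and "P = fps_expansion p 0"
  have H: "h has_fps_expansion H" and F: "f has_fps_expansion F" and P: "p has_fps_expansion P"
    unfolding H_def F_def P_def using h f p by (auto intro!: analytic_at_imp_has_fps_expansion_0 an)
  have ev: "\<forall>\<^sub>F z in nhds (0::complex). z \<in> ball 0 1"
    by (intro eventually_nhds_in_open) auto
  have "(\<lambda>z. z * f z) has_fps_expansion fps_X * F"
    by (intro fps_expansion_intros F)
  then have "h has_fps_expansion fps_X * F"
    by (rule has_fps_expansion_cong[THEN iffD1, rotated 2])
      (use ev f(2) in \<open>auto elim!: eventually_mono\<close>)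
  then have HF: "H = fps_X * F"
    using H fps_expansion_unique_complex by blast
  have "(\<lambda>z. p z * f z) has_fps_expansion P * F"
    by (intro fps_expansion_intros F P)
  then have "deriv h has_fps_expansion P * F"
    by (rule has_fps_expansion_cong[THEN iffD1, rotated 2])
      (use ev f0 in \<open>auto elim!: eventually_mono simp: p_def\<close>)
  then have HP: "fps_deriv H = P * F"
    using has_fps_expansion_deriv[OF H] fps_expansion_unique_complex by blast
  have P_nth: "fps_nth P k = c k" and H_nth: "fps_nth H k = a k" for k
    using fps_nth_fps_expansion[OF P] fps_nth_fps_expansion[OF H] by (simp_all add: c_def a_def)
  have HS: "fps_nth F k = a (Suc k)" for k
    using H_nth[of "Suc k"] by (simp add: HF)
  have c0: "c 0 = 1" by (simp add: c_def p0)
  have a1: "a 1 = 1" by (simp add: a_def h1)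
  \<comment> \<open>Comparing coefficients in \<open>fps_deriv H = P * F\<close>; the indices of
    \<open>a\<close> are shifted because \<open>F\<close> is \<open>H\<close> divided by the
    variable.\<close>
  have rec: "of_nat (Suc n) * a (Suc n) = (\<Sum>i=0..n. c i * a (Suc (n - i)))" for n
    using arg_cong[OF HP, of "\<lambda>A. fps_nth A n"]
    by (simp add: fps_mult_nth H_nth P_nth HS)
  have a2: "a 2 = c 1"
    using rec[of 1] a1 c0 by (simp add: numeral_eq_Suc)
  have a3: "a 3 = (c 2 + (c 1)\<^sup>2) / 2"
    using rec[of 2] a1 c0 a2 by (simp add: numeral_eq_Suc power2_eq_square field_simps)
  have a4: "a 4 = c 3 / 3 + c 1 * c 2 / 2 + c 1 ^ 3 / 6"
  proof -
    have "3 * a 4 = c 3 + (c 1 * c 2 + c 1 * a 3)"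
      using rec[of 3] a1 c0 a2 by (simp add: numeral_eq_Suc algebra_simps)
    then show ?thesis
      by (simp add: a3 power2_eq_square power3_eq_cube field_simps)
  qed
  show ?thesis
    unfolding a2 a3 a4
    by (rule starlike_coefficient_algebra[OF c])
qed

section \<open>Holomorphic functions of several variables are smooth\<close>

lemma norm_vector_smult_complex: "norm ((c::complex) *s x) = cmod c * norm x"
  by (simp add: norm_vec_def norm_mult L2_set_right_distrib)

lemma bounded_bilinear_vector_smult: "bounded_bilinear ((*s) :: complex \<Rightarrow> complex ^ 'n \<Rightarrow> complex ^ 'n)"
proof
  show "\<exists>K. \<forall>a (b :: complex ^ 'n). norm (a *s b) \<le> norm a * norm b * K"
    by (rule exI[of _ 1]) (simp add: norm_vector_smult_complex)
qed (simp_all add: vec_eq_iff algebra_simps)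

lemmas bounded_linear_vector_smult_left =
  bounded_bilinear.bounded_linear_left[OF bounded_bilinear_vector_smult]

lemma scaleR_eq_vector_smult: "r *\<^sub>R x = complex_of_real r *s x"
  by (simp add: vec_eq_iff complex_eq_iff)

lemma holomorphic_fun_on_frechet:
  assumes "holomorphic_fun_on f U" "z \<in> U"
  shows "(f has_derivative frechet_derivative f (at z)) (at z)"
    and "frechet_derivative f (at z) (c *s v) = c * frechet_derivative f (at z) v"
proof -
  obtain f' where f': "(f has_derivative f') (at z)" "\<And>c v. f' (c *s v) = c * f' v"
    using assms unfolding holomorphic_fun_on_def by blast
  then have "f' = frechet_derivative f (at z)" by (intro frechet_derivative_at)
  with f' show "(f has_derivative frechet_derivative f (at z)) (at z)"
    "frechet_derivative f (at z) (c *s v) = c * frechet_derivative f (at z) v" by auto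
qed

text \<open>Complex homogeneity of the derivative turns the real chain rule into complex
  differentiability in \<zeta>, which opens the way to one-variable theory on every complex
  line.\<close>

lemma holomorphic_fun_on_line:
  assumes "holomorphic_fun_on f U" "z + \<zeta> *s v \<in> U"
  shows "((\<lambda>\<zeta>. f (z + \<zeta> *s v)) has_field_derivative frechet_derivative f (at (z + \<zeta> *s v)) v) (at \<zeta>)"
proof -
  have "((\<lambda>\<zeta>. z + \<zeta> *s v) has_derivative (\<lambda>h. h *s v)) (at \<zeta>)"
    by (auto intro!: derivative_eq_intros
        bounded_linear_imp_has_derivative[OF bounded_linear_vector_smult_left])
  from has_derivative_compose[OF this holomorphic_fun_on_frechet(1)[OF assms]]
  show ?thesis
    by (simp add: has_field_derivative_def holomorphic_fun_on_frechet(2)[OF assms] mult_commute_abs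
        mult.commute)
qed

lemma holomorphic_fun_on_line_holomorphic:
  assumes "holomorphic_fun_on f U" "\<And>\<zeta>. \<zeta> \<in> S \<Longrightarrow> z + \<zeta> *s v \<in> U"
  shows "(\<lambda>\<zeta>. f (z + \<zeta> *s v)) holomorphic_on S"
  unfolding holomorphic_on_def field_differentiable_def
  using holomorphic_fun_on_line[OF assms(1) assms(2)] has_field_derivative_at_within by blast

text \<open>Cauchy's inequality on the line in direction \<open>h\<close>, where the ball of radius
  \<open>r\<close> cuts out a disc of radius \<open>r / norm h\<close>.\<close>

lemma holomorphic_fun_on_derivative_bound:
  assumes f: "holomorphic_fun_on f U" and U: "cball z r \<subseteq> U" and r: "r > 0"
    and M: "\<And>x. x \<in> cball z r \<Longrightarrow> cmod (f x) \<le> M"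
  shows "cmod (frechet_derivative f (at z) h) \<le> M / r * norm h"
proof (cases "h = 0")
  case True
  have zU: "z \<in> U" using U r by auto
  then show ?thesis
    using True holomorphic_fun_on_frechet(2)[OF f zU, of 0 0] by simp
next
  case False
  define R where "R = r / norm h"
  have R: "R > 0" using False r by (simp add: R_def)
  have in_ball: "z + \<zeta> *s h \<in> cball z r" if "\<zeta> \<in> cball 0 R" for \<zeta>
    using that False by (simp add: dist_norm norm_vector_smult_complex R_def field_simps)
  have hol: "(\<lambda>\<zeta>. f (z + \<zeta> *s h)) holomorphic_on cball 0 R"
    using in_ball U by (intro holomorphic_fun_on_line_holomorphic[OF f]) auto
  have "cmod ((deriv ^^ 1) (\<lambda>\<zeta>. f (z + \<zeta> *s h)) 0) \<le> fact 1 * M / R ^ 1"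
  proof (rule Cauchy_inequality[OF _ holomorphic_on_imp_continuous_on[OF hol] R])
    show "(\<lambda>\<zeta>. f (z + \<zeta> *s h)) holomorphic_on ball 0 R"
      using hol holomorphic_on_subset ball_subset_cball by blast
    show "cmod (f (z + \<zeta> *s h)) \<le> M" if "cmod (0 - \<zeta>) = R" for \<zeta>
      using that by (intro M in_ball) simp
  qed
  moreover have "deriv (\<lambda>\<zeta>. f (z + \<zeta> *s h)) 0 = frechet_derivative f (at z) h"
    using holomorphic_fun_on_line[OF f, of z 0 h] subsetD[OF U, of z] r by (intro DERIV_imp_deriv) auto
  ultimately show ?thesis by (simp add: R_def field_simps)
qed

text \<open>First-order Taylor formula on the line in direction \<open>v\<close>, with the remainder
  controlled by a Cauchy estimate of the second derivative. The bound depends on \<open>z\<close>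
  only through \<open>M\<close> and \<open>r\<close>, so it will give uniform convergence of
  difference quotients.\<close>

lemma holomorphic_fun_on_difference_quotient:
  assumes f: "holomorphic_fun_on f U" and U: "cball z r \<subseteq> U" and r: "r > 0"
    and M: "\<And>x. x \<in> cball z r \<Longrightarrow> cmod (f x) \<le> M"
    and t: "t * norm v \<le> r / 2" "t > 0"
  shows "cmod ((f (z + t *\<^sub>R v) - f z) / t - frechet_derivative f (at z) v) \<le> 8 * M * (norm v)\<^sup>2 / r\<^sup>2 * t"
proof (cases "v = 0")
  case True
  have zU: "z \<in> U" using U r by auto
  then show ?thesis
    using True holomorphic_fun_on_frechet(2)[OF f zU, of 0 0] by simp
next
  case False
  define R where "R = r / norm v"
  have R: "R > 0" using False r by (simp add: R_def)
  define \<phi> where "\<phi> \<zeta> = f (z + \<zeta> *s v)" for \<zeta>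
  have in_ball: "z + \<zeta> *s v \<in> cball z r" if "\<zeta> \<in> cball 0 R" for \<zeta>
    using that False by (simp add: dist_norm norm_vector_smult_complex R_def field_simps)
  have hol: "\<phi> holomorphic_on cball 0 R"
    unfolding \<phi>_def using in_ball U by (intro holomorphic_fun_on_line_holomorphic[OF f]) auto
  have hol': "\<phi> holomorphic_on ball 0 R"
    using hol holomorphic_on_subset ball_subset_cball by blast
  have sub: "cball w (R/2) \<subseteq> cball 0 R" if "w \<in> cball 0 (R/2)" for w :: complex
    using that by (simp add: cball_subset_cball_iff dist_norm)
  have "\<bar>t\<bar> \<le> R / 2" using t False by (simp add: R_def field_simps)
  have "cmod ((deriv ^^ 0) \<phi> (of_real t) - (\<Sum>i\<le>1. (deriv ^^ i) \<phi> 0 * (of_real t - 0) ^ i / fact i))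
     \<le> (8 * M / R\<^sup>2) * cmod (of_real t - 0) ^ Suc 1 / fact 1"
  proof (rule complex_Taylor[where S = "cball 0 (R/2)"])
    fix i :: nat and x :: complex assume x: "x \<in> cball 0 (R/2)"
    then have "x \<in> ball 0 R" using R by simp
    then have "((deriv ^^ i) \<phi> has_field_derivative (deriv ^^ Suc i) \<phi> x) (at x)"
      using holomorphic_derivI[OF holomorphic_higher_deriv[OF hol' open_ball, of i] open_ball] by simp
    then show "((deriv ^^ i) \<phi> has_field_derivative (deriv ^^ Suc i) \<phi> x) (at x within cball 0 (R/2))"
      by (rule has_field_derivative_at_within)
  next
    fix x :: complex assume x: "x \<in> cball 0 (R/2)"
    \<comment> \<open>Around each point of the half disc a disc of radius \<open>R/2\<close> still
      fits, and \<open>fact 2\<close> times the square of 2 accounts for the constant 8.\<close>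
    have "cmod ((deriv ^^ 2) \<phi> x) \<le> fact 2 * M / (R/2) ^ 2"
    proof (rule Cauchy_inequality)
      have h: "\<phi> holomorphic_on cball x (R/2)" using sub[OF x] hol holomorphic_on_subset by blast
      then show "\<phi> holomorphic_on ball x (R/2)" "continuous_on (cball x (R/2)) \<phi>"
        using holomorphic_on_subset ball_subset_cball holomorphic_on_imp_continuous_on by blast+
      show "cmod (\<phi> y) \<le> M" if "cmod (x - y) = R/2" for y
        unfolding \<phi>_def using sub[OF x] that by (intro M in_ball) (auto simp: dist_norm)
    qed (use R in simp)
    then show "cmod ((deriv ^^ Suc 1) \<phi> x) \<le> 8 * M / R\<^sup>2"
      by (simp add: numeral_2_eq_2 power_divide field_simps)
  qed (use R \<open>\<bar>t\<bar> \<le> R / 2\<close> in auto)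
  moreover have "deriv \<phi> 0 = frechet_derivative f (at z) v"
    unfolding \<phi>_def using holomorphic_fun_on_line[OF f, of z 0 v] subsetD[OF U, of z] r
    by (intro DERIV_imp_deriv) auto
  ultimately have "cmod (f (z + t *\<^sub>R v) - f z - t * frechet_derivative f (at z) v)
      \<le> 8 * M / R\<^sup>2 * t ^ 2"
    using t by (simp add: \<phi>_def scaleR_eq_vector_smult mult.commute algebra_simps power2_eq_square)
  then have "cmod (f (z + t *\<^sub>R v) - f z - t * frechet_derivative f (at z) v) / t \<le> 8 * M / R\<^sup>2 * t"
    using t by (simp add: field_simps power2_eq_square)
  moreover have "cmod ((f (z + t *\<^sub>R v) - f z) / t - frechet_derivative f (at z) v)
      = cmod (f (z + t *\<^sub>R v) - f z - t * frechet_derivative f (at z) v) / t"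
  proof -
    have "(f (z + t *\<^sub>R v) - f z) / t - frechet_derivative f (at z) v
       = (f (z + t *\<^sub>R v) - f z - t * frechet_derivative f (at z) v) / t"
      using t by (simp add: field_simps)
    then show ?thesis using t by (simp add: norm_divide)
  qed
  moreover have "8 * M / R\<^sup>2 * t = 8 * M * (norm v)\<^sup>2 / r\<^sup>2 * t"
    by (simp add: R_def power_divide)
  ultimately show ?thesis by simp
qed

section \<open>Uniform limits and directional derivatives\<close>

text \<open>Weierstrass' theorem: by the Cauchy estimate a uniformly Cauchy sequence has derivatives
  that are uniformly Cauchy on the half ball, so limit and derivative may be interchanged; complex
  homogeneity passes to the pointwise limit.\<close>

lemma holomorphic_fun_uniform_limit:
  assumes f: "\<And>n. holomorphic_fun_on (f n) (ball z0 R)" and R: "R > 0"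
    and lim: "uniform_limit (ball z0 R) f g sequentially"
  shows "\<exists>g'. (g has_derivative g') (at z0) \<and> (\<forall>c v. g' (c *s v) = c * g' v)"
proof -
  define D where "D n z = frechet_derivative (f n) (at z)" for n z
  define S where "S = ball z0 (R/2)"
  have S: "S \<subseteq> ball z0 R" "z0 \<in> S" "open S" "convex S" using R by (auto simp: S_def)
  have Df: "(f n has_derivative D n z) (at z)" if "z \<in> S" for n z
    unfolding D_def using holomorphic_fun_on_frechet(1)[OF f] that S by blast
  have Dc: "D n z (c *s v) = c * D n z v" if "z \<in> S" for n z c v
    unfolding D_def using holomorphic_fun_on_frechet(2)[OF f] that S by blast
  have Cauchy: "\<exists>N. \<forall>m\<ge>N. \<forall>n\<ge>N. \<forall>z\<in>S. \<forall>h. cmod (D m z h - D n z h) \<le> e * norm h" if "e > 0" for e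
  proof -
    have "e * R / 4 > 0" using \<open>e > 0\<close> R by simp
    moreover have "uniformly_Cauchy_on (ball z0 R) f"
      using lim by (intro uniformly_convergent_Cauchy) (auto simp: uniformly_convergent_on_def)
    ultimately obtain N where N: "\<And>m n x. m \<ge> N \<Longrightarrow> n \<ge> N \<Longrightarrow> x \<in> ball z0 R \<Longrightarrow> dist (f m x) (f n x) < e * R / 4"
      unfolding uniformly_Cauchy_on_def by meson
    have "cmod (D m z h - D n z h) \<le> e * norm h" if "m \<ge> N" "n \<ge> N" "z \<in> S" for m n z h
    proof -
      define u where "u = (\<lambda>x. f m x - f n x)"
      have u: "(u has_derivative (\<lambda>h. frechet_derivative (f m) (at x) h - frechet_derivative (f n) (at x) h)) (at x)"
        if "x \<in> ball z0 R" for x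
        unfolding u_def using that holomorphic_fun_on_frechet(1)[OF f] by (intro has_derivative_diff)
      have "holomorphic_fun_on u (ball z0 R)"
        unfolding holomorphic_fun_on_def
        using u holomorphic_fun_on_frechet(2)[OF f]
        by (force simp: right_diff_distrib)
      moreover have sub: "cball z (R/4) \<subseteq> ball z0 R"
      proof
        fix x assume "x \<in> cball z (R/4)"
        then show "x \<in> ball z0 R"
          using \<open>z \<in> S\<close> R dist_triangle[of z0 x z] by (simp add: S_def)
      qed
      ultimately have "cmod (frechet_derivative u (at z) h) \<le> (e * R / 4) / (R/4) * norm h"
        using N[OF that(1,2)] R
        by (intro holomorphic_fun_on_derivative_bound) (auto simp: u_def dist_norm subset_iff less_imp_le)
      moreover have "frechet_derivative u (at z) = (\<lambda>h. D m z h - D n z h)"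
        unfolding D_def by (rule frechet_derivative_at[OF u, symmetric]) (use that(3) S(1) in blast)
      ultimately show ?thesis using R by simp
    qed
    then show ?thesis by blast
  qed
  define g' where "g' z h = lim (\<lambda>n. D n z h)" for z h
  have g': "(\<lambda>n. D n z h) \<longlonglongrightarrow> g' z h" if "z \<in> S" for z h
  proof -
    have "Cauchy (\<lambda>n. D n z h)"
    proof (rule metric_CauchyI)
      fix e :: real assume "e > 0"
      \<comment> \<open>The summand 1 covers \<open>h = 0\<close>.\<close>
      then have "e / (norm h + 1) > 0" by (simp add: add_nonneg_pos)
      from Cauchy[OF this] obtain N where
        N: "\<forall>m\<ge>N. \<forall>n\<ge>N. \<forall>z\<in>S. \<forall>h'. cmod (D m z h' - D n z h') \<le> e / (norm h + 1) * norm h'"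
        by (elim exE)
      have "e / (norm h + 1) * norm h < e"
        using \<open>e > 0\<close> add_pos_nonneg[OF zero_less_one norm_ge_zero[of h]]
        by (simp add: pos_divide_less_eq add.commute algebra_simps)
      moreover have "dist (D m z h) (D n z h) \<le> e / (norm h + 1) * norm h" if "m \<ge> N" "n \<ge> N" for m n
        unfolding dist_norm using N that \<open>z \<in> S\<close> by simp
      ultimately show "\<exists>M. \<forall>m\<ge>M. \<forall>n\<ge>M. dist (D m z h) (D n z h) < e"
        by (intro exI[of _ N]) (auto intro: le_less_trans)
    qed
    then show ?thesis
      unfolding g'_def by (simp add: Cauchy_convergent_iff convergent_LIMSEQ_iff)
  qed
  have "\<exists>G. \<forall>x\<in>S. (\<lambda>n. f n x) \<longlonglongrightarrow> G x \<and> (G has_derivative g' x) (at x within S)"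
  proof (rule has_derivative_sequence[OF \<open>convex S\<close>])
    show "(f n has_derivative D n x) (at x within S)" if "x \<in> S" for n x
      using Df[OF that] by (rule has_derivative_at_withinI)
    show "\<forall>\<^sub>F n in sequentially. \<forall>x\<in>S. \<forall>h. cmod (D n x h - g' x h) \<le> e * norm h" if e: "e > 0" for e
    proof -
      from Cauchy[OF e] obtain N where
        N: "\<forall>m\<ge>N. \<forall>n\<ge>N. \<forall>z\<in>S. \<forall>h. cmod (D m z h - D n z h) \<le> e * norm h"
        by (elim exE)
      have "cmod (D n z h - g' z h) \<le> e * norm h" if "n \<ge> N" "z \<in> S" for n z h
      proof (rule tendsto_upperbound)
        show "(\<lambda>m. cmod (D n z h - D m z h)) \<longlonglongrightarrow> cmod (D n z h - g' z h)"
          by (intro tendsto_intros g' that)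
        show "\<forall>\<^sub>F m in sequentially. cmod (D n z h - D m z h) \<le> e * norm h"
          using N that by (intro eventually_sequentiallyI[of N]) simp
      qed simp
      then show ?thesis by (auto simp: eventually_sequentially)
    qed
    show "z0 \<in> S" by fact
    show "(\<lambda>n. f n z0) \<longlonglongrightarrow> g z0"
      using lim R by (intro tendsto_uniform_limitI[OF lim]) simp
  qed
  then obtain G where G: "\<And>x. x \<in> S \<Longrightarrow> (\<lambda>n. f n x) \<longlonglongrightarrow> G x"
      "\<And>x. x \<in> S \<Longrightarrow> (G has_derivative g' x) (at x within S)" by blast
  have "G x = g x" if "x \<in> S" for x
    using G(1)[OF that] tendsto_uniform_limitI[OF lim, of x] that S LIMSEQ_unique by blast
  then have "(g has_derivative g' z0) (at z0)"
    using has_derivative_transform[OF \<open>z0 \<in> S\<close> _ G(2)[OF \<open>z0 \<in> S\<close>], of g] S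
      at_within_open[OF \<open>z0 \<in> S\<close> \<open>open S\<close>] by simp
  moreover have "g' z0 (c *s v) = c * g' z0 v" for c v
  proof (rule LIMSEQ_unique)
    show "(\<lambda>n. D n z0 (c *s v)) \<longlonglongrightarrow> g' z0 (c *s v)" by (rule g') fact
    show "(\<lambda>n. D n z0 (c *s v)) \<longlonglongrightarrow> c * g' z0 v"
      unfolding Dc[OF \<open>z0 \<in> S\<close>] by (intro tendsto_intros g') fact
  qed
  ultimately show ?thesis by blast
qed

text \<open>The difference quotients in direction \<open>v\<close> are holomorphic and converge
  locally uniformly to the directional derivative. Iterating this makes a holomorphic function
  infinitely differentiable.\<close>

lemma holomorphic_fun_on_directional_derivative:
  assumes f: "holomorphic_fun_on f U"
  shows "holomorphic_fun_on (\<lambda>z. frechet_derivative f (at z) v) U"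
  unfolding holomorphic_fun_on_def
proof (intro conjI ballI)
  show U: "open U" using f by (simp add: holomorphic_fun_on_def)
  fix z0 assume "z0 \<in> U"
  then obtain R' where R': "R' > 0" "cball z0 R' \<subseteq> U" using U open_contains_cball by blast
  \<comment> \<open>Leaves room for a closed ball of radius \<open>R\<close> around every point of
    \<open>ball z0 R\<close>, inside the region where \<open>f\<close> is bounded by
    \<open>M\<close>.\<close>
  define R where "R = R' / 3"
  have R: "R > 0" "cball z0 (3 * R) \<subseteq> U" using R' by (auto simp: R_def)
  have sub: "cball z R \<subseteq> cball z0 (3 * R)" if "z \<in> ball z0 R" for z
    using that R by (simp add: cball_subset_cball_iff dist_commute)
  have "continuous_on U f"
    using holomorphic_fun_on_frechet(1)[OF f] has_derivative_continuous continuous_at_imp_continuous_on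
    by blast
  then have "compact (f ` cball z0 (3 * R))"
    by (intro compact_continuous_image[OF continuous_on_subset[OF _ R(2)]] compact_cball)
  then have "bounded (f ` cball z0 (3 * R))" by (rule compact_imp_bounded)
  then obtain M where M: "\<And>x. x \<in> cball z0 (3 * R) \<Longrightarrow> cmod (f x) \<le> M"
    unfolding bounded_iff by blast
  define T where "T = R / (2 * (norm v + 1))"
  have nv: "norm v + 1 > 0" by (simp add: add_nonneg_pos)
  then have T: "T > 0" "T * norm v \<le> R / 2"
    using R by (auto simp: T_def field_simps)
  define t where "t n = T / Suc n" for n
  have t: "t n > 0" "t n * norm v \<le> R / 2" for n
  proof -
    show "t n > 0" using T by (simp add: t_def)
    have "t n \<le> T" using T by (simp add: t_def field_simps)
    then have "t n * norm v \<le> T * norm v" by (intro mult_right_mono) auto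
    then show "t n * norm v \<le> R / 2" using T by simp
  qed
  have tlim: "t \<longlonglongrightarrow> 0"
    unfolding t_def using LIMSEQ_Suc[OF lim_const_over_n[of T]] by simp
  define F where "F n z = (f (z + t n *\<^sub>R v) - f z) / t n" for n z
  show "\<exists>f'. ((\<lambda>z. frechet_derivative f (at z) v) has_derivative f') (at z0) \<and> (\<forall>c v. f' (c *s v) = c * f' v)"
  proof (rule holomorphic_fun_uniform_limit[OF _ R(1)])
    fix n
    show "holomorphic_fun_on (F n) (ball z0 R)"
      unfolding holomorphic_fun_on_def
    proof (intro conjI ballI)
      fix z assume z: "z \<in> ball z0 R"
      have "z + t n *\<^sub>R v \<in> cball z R" "z \<in> cball z R"
        using t[of n] R by (simp_all add: dist_norm)
      then have zU: "z + t n *\<^sub>R v \<in> U" "z \<in> U" using sub[OF z] R(2) by blast+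
      define f' where "f' h = (frechet_derivative f (at (z + t n *\<^sub>R v)) h - frechet_derivative f (at z) h) / t n" for h
      have sh: "((\<lambda>z. z + t n *\<^sub>R v) has_derivative (\<lambda>h. h)) (at z)"
        by (auto intro!: derivative_eq_intros)
      have "((\<lambda>z. f (z + t n *\<^sub>R v)) has_derivative frechet_derivative f (at (z + t n *\<^sub>R v))) (at z)"
        using has_derivative_compose[OF sh holomorphic_fun_on_frechet(1)[OF f zU(1)]] .
      then have "(F n has_derivative f') (at z)"
        unfolding F_def f'_def
        using holomorphic_fun_on_frechet(1)[OF f zU(2)]
        by (intro bounded_linear.has_derivative[OF bounded_linear_divide] has_derivative_diff)
      moreover have "\<forall>c v. f' (c *s v) = c * f' v"
        by (simp add: f'_def holomorphic_fun_on_frechet(2)[OF f] zU algebra_simps diff_divide_distrib)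
      ultimately show "\<exists>f'. (F n has_derivative f') (at z) \<and> (\<forall>c v. f' (c *s v) = c * f' v)" by blast
    qed simp
  next
    show "uniform_limit (ball z0 R) F (\<lambda>z. frechet_derivative f (at z) v) sequentially"
    proof (rule uniform_limitI)
      fix e :: real assume "e > 0"
      have "(\<lambda>n. 8 * M * (norm v)\<^sup>2 / R\<^sup>2 * t n) \<longlonglongrightarrow> 8 * M * (norm v)\<^sup>2 / R\<^sup>2 * 0"
        by (intro tendsto_intros tlim)
      then have "\<forall>\<^sub>F n in sequentially. 8 * M * (norm v)\<^sup>2 / R\<^sup>2 * t n < e"
        using \<open>e > 0\<close> by (intro order_tendstoD) auto
      then show "\<forall>\<^sub>F n in sequentially. \<forall>z\<in>ball z0 R. dist (F n z) (frechet_derivative f (at z) v) < e"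
      proof (rule eventually_mono, intro ballI)
        fix n z assume n: "8 * M * (norm v)\<^sup>2 / R\<^sup>2 * t n < e" and z: "z \<in> ball z0 R"
        have "cmod (F n z - frechet_derivative f (at z) v) \<le> 8 * M * (norm v)\<^sup>2 / R\<^sup>2 * t n"
          unfolding F_def
          by (rule holomorphic_fun_on_difference_quotient[OF f _ R(1) _ t(2) t(1)])
            (use sub[OF z] R(2) M in blast)+
        then show "dist (F n z) (frechet_derivative f (at z) v) < e" using n by (simp add: dist_norm)
      qed
    qed
  qed
qed

section \<open>Iterated Frechet derivatives\<close>

text \<open>A class of smooth maps with values in an arbitrary normed space (so that it contains the
  operator-valued derivatives) that is closed under differentiation.\<close>

inductive holomorphic_span :: "(complex ^ 'n) set \<Rightarrow> (complex ^ 'n \<Rightarrow> 'w::real_normed_vector) \<Rightarrow> bool"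
  for U where
  Re: "holomorphic_fun_on f U \<Longrightarrow> holomorphic_span U (\<lambda>z. Re (f z) *\<^sub>R w)"
| add: "holomorphic_span U G \<Longrightarrow> holomorphic_span U H \<Longrightarrow> holomorphic_span U (\<lambda>z. G z + H z)"
| cong: "holomorphic_span U G \<Longrightarrow> (\<And>z. z \<in> U \<Longrightarrow> G z = H z) \<Longrightarrow> holomorphic_span U H"

lemma holomorphic_span_sum:
  assumes "finite B" "B \<noteq> {}" "\<And>b. b \<in> B \<Longrightarrow> holomorphic_span U (G b)"
  shows "holomorphic_span U (\<lambda>z. \<Sum>b\<in>B. G b z)"
  using assms by (induction B rule: finite_ne_induct) (auto intro: holomorphic_span.add)

text \<open>The derivative of a generator expands over the real basis into \<open>Re\<close> of
  directional derivatives, which are again holomorphic, times fixed operators. Only the target space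
  changes, so the class is stable under differentiation.\<close>

lemma holomorphic_span_has_derivative:
  fixes G :: "complex ^ 'n \<Rightarrow> 'w::real_normed_vector"
  assumes "holomorphic_span U G" and U: "open U"
  shows "\<exists>G'. (\<forall>z\<in>U. (G has_derivative blinfun_apply (G' z)) (at z)) \<and> holomorphic_span U G'"
  using assms(1)
proof induction
  case (Re f w)
  \<comment> \<open>The rank-one operator sending \<open>h\<close> to
    \<open>(h \<bullet> b) *\<^sub>R w\<close>.\<close>
  define T where "T b = blinfun_scaleR_left w o\<^sub>L blinfun_inner_left b" for b :: "complex ^ 'n"
  define G' where "G' z = (\<Sum>b\<in>Basis. Re (frechet_derivative f (at z) b) *\<^sub>R T b)" for z
  have "holomorphic_span U G'"
    unfolding G'_def
    by (intro holomorphic_span_sum holomorphic_span.Re holomorphic_fun_on_directional_derivative Re) auto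
  moreover have "((\<lambda>z. Re (f z) *\<^sub>R w) has_derivative blinfun_apply (G' z)) (at z)" if "z \<in> U" for z
  proof -
    have D: "(f has_derivative frechet_derivative f (at z)) (at z)"
      by (rule holomorphic_fun_on_frechet(1)[OF Re that])
    have "((\<lambda>z. Re (f z) *\<^sub>R w) has_derivative (\<lambda>h. Re (frechet_derivative f (at z) h) *\<^sub>R w)) (at z)"
      by (intro bounded_linear.has_derivative[OF bounded_linear_scaleR_left]
          bounded_linear.has_derivative[OF bounded_linear_Re] D)
    moreover have "Re (frechet_derivative f (at z) h) *\<^sub>R w = blinfun_apply (G' z) h" for h
    proof -
      interpret L: linear "\<lambda>h. Re (frechet_derivative f (at z) h)"
        using bounded_linear_compose[OF bounded_linear_Re has_derivative_bounded_linear[OF D]]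
        by (simp add: bounded_linear.linear)
      have "Re (frechet_derivative f (at z) h)
          = Re (frechet_derivative f (at z) (\<Sum>b\<in>Basis. (h \<bullet> b) *\<^sub>R b))"
        by (simp add: euclidean_representation)
      also have "\<dots> = (\<Sum>b\<in>Basis. (h \<bullet> b) * Re (frechet_derivative f (at z) b))"
        by (simp add: L.sum L.scale)
      finally show ?thesis
        by (simp add: G'_def T_def blinfun.sum_left blinfun.scaleR_left scaleR_sum_left mult.commute)
    qed
    ultimately show ?thesis by simp
  qed
  ultimately show ?case by blast
next
  case (add G H)
  then obtain G' H' where "holomorphic_span U G'" "holomorphic_span U H'"
    and "\<And>z. z \<in> U \<Longrightarrow> (G has_derivative blinfun_apply (G' z)) (at z)"
    and "\<And>z. z \<in> U \<Longrightarrow> (H has_derivative blinfun_apply (H' z)) (at z)" by blast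
  then show ?case
    by (intro exI[of _ "\<lambda>z. G' z + H' z"])
      (auto simp: plus_blinfun.rep_eq intro!: holomorphic_span.add has_derivative_add)
next
  case (cong G H)
  then obtain G' where G': "holomorphic_span U G'"
    "\<And>z. z \<in> U \<Longrightarrow> (G has_derivative blinfun_apply (G' z)) (at z)" by blast
  have "(H has_derivative blinfun_apply (G' z)) (at z)" if "z \<in> U" for z
    using has_derivative_transform_within_open[OF G'(2)[OF that] U that] cong.hyps(2) by blast
  with G' show ?case by blast
qed

text \<open>\<open>Frechet\<close> is a total function, meaningful only where a derivative exists;
  uniqueness of derivatives identifies it on \<open>U\<close> with the map just constructed, so
  every iterate is a genuine derivative.\<close>

lemma holomorphic_span_Frechet:
  assumes "holomorphic_span U G" and U: "open U"
  shows "z \<in> U \<Longrightarrow> (G has_derivative blinfun_apply (Frechet G z)) (at z)"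
    and "holomorphic_span U (Frechet G)"
proof -
  obtain G' where G': "\<And>z. z \<in> U \<Longrightarrow> (G has_derivative blinfun_apply (G' z)) (at z)"
    and "holomorphic_span U G'"
    using holomorphic_span_has_derivative[OF assms] by blast
  moreover have eq: "G' z = Frechet G z" if "z \<in> U" for z
    unfolding Frechet_def frechet_derivative_at[OF G'[OF that], symmetric]
    by (rule blinfun_apply_inverse[symmetric])
  ultimately show "holomorphic_span U (Frechet G)"
    using holomorphic_span.cong by blast
  show "(G has_derivative blinfun_apply (Frechet G z)) (at z)" if "z \<in> U"
    using G'[OF that] eq[OF that] by simp
qed

lemma holomorphic_span_line_derivative:
  assumes "holomorphic_span U G" and "open U" and "t *\<^sub>R z \<in> U"
  shows "((\<lambda>t. G (t *\<^sub>R z)) has_vector_derivative Frechet G (t *\<^sub>R z) z) (at t)"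
proof -
  have "((\<lambda>t. t *\<^sub>R z) has_derivative (\<lambda>s. s *\<^sub>R z)) (at t)"
    by (auto intro!: derivative_eq_intros)
  from has_derivative_compose[OF this holomorphic_span_Frechet(1)[OF assms]]
  show ?thesis by (simp add: has_vector_derivative_def blinfun.scaleR_right)
qed

text \<open>Each real component of \<open>f z *s z\<close> is the real part of a holomorphic
  function, namely \<open>f z * (z $ j * cnj c)\<close> for the basis vector
  \<open>axis j c\<close>.\<close>

lemma holomorphic_fun_on_imp_holomorphic_span:
  fixes f :: "complex ^ 'n \<Rightarrow> complex"
  assumes f: "holomorphic_fun_on f U"
  shows "holomorphic_span U (\<lambda>z. f z *s z)"
proof -
  have "holomorphic_span U (\<lambda>z. \<Sum>b\<in>Basis. ((f z *s z) \<bullet> b) *\<^sub>R b)"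
  proof (rule holomorphic_span_sum)
    fix b :: "complex ^ 'n" assume "b \<in> Basis"
    then obtain j c where b: "b = axis j c" by (auto simp: Basis_vec_def)
    have "holomorphic_fun_on (\<lambda>z. f z * (z $ j * cnj c)) U"
      unfolding holomorphic_fun_on_def
    proof (intro conjI ballI)
      show "open U" using f by (simp add: holomorphic_fun_on_def)
      fix z assume z: "z \<in> U"
      have "((\<lambda>z. z $ j * cnj c) has_derivative (\<lambda>h. h $ j * cnj c)) (at z)"
        by (auto intro!: bounded_linear_imp_has_derivative bounded_linear_mult_const bounded_linear_vec_nth)
      from has_derivative_mult[OF holomorphic_fun_on_frechet(1)[OF f z] this]
      show "\<exists>f'. ((\<lambda>z. f z * (z $ j * cnj c)) has_derivative f') (at z) \<and> (\<forall>c v. f' (c *s v) = c * f' v)"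
        by (intro exI conjI, assumption) (simp add: holomorphic_fun_on_frechet(2)[OF f z] algebra_simps)
    qed
    then have "holomorphic_span U (\<lambda>z. Re (f z * (z $ j * cnj c)) *\<^sub>R b)"
      by (rule holomorphic_span.Re)
    moreover have "(f z *s z) \<bullet> b = Re (f z * (z $ j * cnj c))" for z
      by (simp add: b inner_axis inner_complex_def algebra_simps)
    ultimately show "holomorphic_span U (\<lambda>z. ((f z *s z) \<bullet> b) *\<^sub>R b)"
      by simp
  qed auto
  then show ?thesis by (simp add: euclidean_representation)
qed

text \<open>On the real line through \<open>z\<close> the map is
  \<open>F (t *\<^sub>R z) = K t *s z\<close>. Differentiating both sides repeatedly in the real
  variable \<open>t\<close> and comparing by uniqueness reduces the multilinear derivatives to those
  of the one-variable function \<open>K\<close>.\<close>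

lemma Frechet_powers_line:
  fixes f :: "complex ^ 'n \<Rightarrow> complex" and z :: "complex ^ 'n"
  assumes f: "holomorphic_fun_on f U" and "0 \<in> U"
  defines "F \<equiv> \<lambda>z. f z *s z" and "K \<equiv> \<lambda>\<zeta>. \<zeta> * f (\<zeta> *s z)"
  shows "D2_diag F 0 z = (deriv ^^ 2) K 0 *s z" and "D3_diag F 0 z = (deriv ^^ 3) K 0 *s z"
    and "D4_diag F 0 z = (deriv ^^ 4) K 0 *s z"
proof -
  have U: "open U" using f by (simp add: holomorphic_fun_on_def)
  define T where "T = {\<zeta>. \<zeta> *s z \<in> U}"
  define S where "S = {t. t *\<^sub>R z \<in> U}"
  have "open T"
    unfolding T_def
    using open_vimage[OF U linear_continuous_on[OF bounded_linear_vector_smult_left]]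
    by (simp add: vimage_def)
  have "open S"
    unfolding S_def using open_vimage[OF U, of "\<lambda>t. t *\<^sub>R z"]
    by (simp add: vimage_def continuous_intros)
  have ST: "of_real t \<in> T" if "t \<in> S" for t
    using that by (simp add: S_def T_def scaleR_eq_vector_smult)
  have "0 \<in> S" using \<open>0 \<in> U\<close> by (simp add: S_def)
  have K: "K holomorphic_on T"
    unfolding K_def using holomorphic_fun_on_line_holomorphic[OF f, of T 0 z]
    by (auto simp: T_def intro!: holomorphic_intros)
  have step: "\<psi>' t = (deriv ^^ Suc k) K (of_real t) *s z"
    if \<psi>: "\<And>t. t \<in> S \<Longrightarrow> \<psi> t = (deriv ^^ k) K (of_real t) *s z"
      and \<psi>': "\<And>t. t \<in> S \<Longrightarrow> (\<psi> has_vector_derivative \<psi>' t) (at t)"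
      and t: "t \<in> S" for \<psi> \<psi>' k t
  proof -
    have "((deriv ^^ k) K has_field_derivative (deriv ^^ Suc k) K (of_real t)) (at (of_real t))"
      using holomorphic_derivI[OF holomorphic_higher_deriv[OF K \<open>open T\<close>] \<open>open T\<close> ST[OF t], of k] by simp
    then have "((\<lambda>t. (deriv ^^ k) K (of_real t)) has_vector_derivative (deriv ^^ Suc k) K (of_real t)) (at t)"
      by (rule has_vector_derivative_real_field)
    then have "((\<lambda>t. (deriv ^^ k) K (of_real t) *s z) has_vector_derivative (deriv ^^ Suc k) K (of_real t) *s z) (at t)"
      by (rule bounded_linear.has_vector_derivative[OF bounded_linear_vector_smult_left])
    then have "(\<psi> has_vector_derivative (deriv ^^ Suc k) K (of_real t) *s z) (at t)"
      using \<psi> t \<open>open S\<close> by (auto intro: has_vector_derivative_transform_within_open)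
    then show ?thesis using \<psi>'[OF t] vector_derivative_unique_at by blast
  qed
  have F: "holomorphic_span U F"
    unfolding F_def by (rule holomorphic_fun_on_imp_holomorphic_span[OF f])
  note F1 = holomorphic_span_Frechet(2)[OF F U]
  note F2 = holomorphic_span_Frechet(2)[OF F1 U]
  note F3 = holomorphic_span_Frechet(2)[OF F2 U]
  \<comment> \<open>Evaluation at the fixed vector \<open>z\<close> is bounded linear, hence
    commutes with differentiation in \<open>t\<close>.\<close>
  note ap = bounded_linear.has_vector_derivative[OF blinfun.bounded_linear_left]
  have 0: "F (t *\<^sub>R z) = (deriv ^^ 0) K (of_real t) *s z" if "t \<in> S" for t
    by (simp add: F_def K_def scaleR_eq_vector_smult vector_smult_assoc mult.commute)
  note line = holomorphic_span_line_derivative[OF _ U]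
  have 1: "Frechet F (t *\<^sub>R z) z = (deriv ^^ Suc 0) K (of_real t) *s z" if "t \<in> S" for t
    by (rule step[OF 0 line[OF F] that]) (simp_all add: S_def)
  have 2: "Frechet (Frechet F) (t *\<^sub>R z) z z = (deriv ^^ Suc (Suc 0)) K (of_real t) *s z" if "t \<in> S" for t
    by (rule step[OF 1 ap[OF line[OF F1]] that]) (simp_all add: S_def)
  have 3: "Frechet (Frechet (Frechet F)) (t *\<^sub>R z) z z z = (deriv ^^ Suc (Suc (Suc 0))) K (of_real t) *s z"
    if "t \<in> S" for t
    by (rule step[OF 2 ap[OF ap[OF line[OF F2]]] that]) (simp_all add: S_def)
  have 4: "Frechet (Frechet (Frechet (Frechet F))) (t *\<^sub>R z) z z z z
      = (deriv ^^ Suc (Suc (Suc (Suc 0)))) K (of_real t) *s z" if "t \<in> S" for t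
    by (rule step[OF 3 ap[OF ap[OF ap[OF line[OF F3]]]] that]) (simp_all add: S_def)
  show "D2_diag F 0 z = (deriv ^^ 2) K 0 *s z"
    using 2[OF \<open>0 \<in> S\<close>] by (simp add: D2_diag_def numeral_eq_Suc)
  show "D3_diag F 0 z = (deriv ^^ 3) K 0 *s z"
    using 3[OF \<open>0 \<in> S\<close>] by (simp add: D3_diag_def numeral_eq_Suc)
  show "D4_diag F 0 z = (deriv ^^ 4) K 0 *s z"
    using 4[OF \<open>0 \<in> S\<close>] by (simp add: D4_diag_def numeral_eq_Suc)
qed

section \<open>Exceptional sets, Minkowski functionals and restriction to discs\<close>

text \<open>Locally \<open>M\<close> is the image of part of a proper subspace under the
  differentiable map \<open>\<psi>\<close>, and such maps send null sets to null sets in equal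
  dimension.\<close>

lemma C1_submanifold_negligible:
  fixes M :: "'a::euclidean_space set"
  assumes M: "C1_submanifold d M" and d: "d < DIM('a)"
  shows "negligible M"
proof (rule locally_negligible_alt[THEN iffD2], rule ballI)
  fix p assume "p \<in> M"
  with M obtain U and V :: "'a set" and \<phi> \<psi> L where U: "open U" "p \<in> U" and hom: "homeomorphism U V \<phi> \<psi>"
    and \<psi>: "C1_on \<psi> V" and L: "dim L = d" and eq: "\<phi> ` (M \<inter> U) = L \<inter> V"
    unfolding C1_submanifold_def by meson
  have "negligible (L \<inter> V)"
    using negligible_lowdim[of L] d L negligible_subset by blast
  moreover have "\<psi> differentiable_on L \<inter> V"
    using \<psi> unfolding C1_on_def differentiable_on_def differentiable_def
    by (blast intro: has_derivative_at_withinI)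
  ultimately have "negligible (\<psi> ` (L \<inter> V))"
    by (intro negligible_differentiable_image_negligible) auto
  moreover have "M \<inter> U = \<psi> ` (L \<inter> V)"
    unfolding eq[symmetric] image_image
    using homeomorphism_apply1[OF hom] by force
  moreover have "openin (top_of_set M) (M \<inter> U)"
    using U(1) by (rule openin_open_Int)
  ultimately show "\<exists>U. openin (top_of_set M) U \<and> p \<in> U \<and> negligible U"
    using U(2) \<open>p \<in> M\<close> by auto
qed

lemma exceptional_set_negligible:
  fixes E :: "'a::euclidean_space set"
  assumes "exceptional_set E"
  shows "negligible E"
proof -
  obtain \<M> where \<M>: "countable \<M>" "E = \<Union>\<M>"
    and "\<forall>M\<in>\<M>. \<exists>d<DIM('a). C1_submanifold d M"
    using assms unfolding exceptional_set_def by (elim exE conjE)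
  then have "negligible M" if "M \<in> \<M>" for M
    using that C1_submanifold_negligible[of _ M] by auto
  with \<M> show ?thesis
    by (simp add: negligible_countable_Union)
qed

section \<open>The Wirtinger derivative of the Minkowski functional\<close>

text \<open>The right-hand side is the complex linear part of the real linear form \<open>D\<close>;
  both sides are compared in the real basis \<open>axis j 1\<close>,
  \<open>axis j \<i>\<close>.\<close>

lemma row_times_column_wirtinger_row:
  fixes \<rho> :: "complex ^ 'n \<Rightarrow> real"
  assumes D: "(\<rho> has_derivative D) (at z)"
  shows "row_times_column (wirtinger_row \<rho> z) v = (of_real (D v) - \<i> * of_real (D (\<i> *s v))) / 2"
proof -
  have dir: "deriv (\<lambda>t::real. \<rho> (z + t *\<^sub>R b)) 0 = D b" for b
  proof (rule DERIV_imp_deriv)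
    have line: "((\<lambda>t::real. z + t *\<^sub>R b) has_derivative (\<lambda>t. t *\<^sub>R b)) (at 0)"
      by (auto intro!: derivative_eq_intros)
    have "((\<lambda>t::real. \<rho> (z + t *\<^sub>R b)) has_derivative (\<lambda>t. D (t *\<^sub>R b))) (at 0)"
      using has_derivative_compose[OF line, of \<rho> D] D by simp
    then show "((\<lambda>t::real. \<rho> (z + t *\<^sub>R b)) has_field_derivative D b) (at 0)"
      by (simp add: has_field_derivative_def linear_scale[OF has_derivative_linear[OF D]] mult_commute_abs)
  qed
  interpret linear D by (rule has_derivative_linear[OF D])
  have rep: "u = (\<Sum>j\<in>UNIV. Re (u $ j) *\<^sub>R axis j 1 + Im (u $ j) *\<^sub>R axis j \<i>)" for u :: "complex ^ 'n"
    by (simp add: vec_eq_iff axis_def complex_eq_iff sum.distrib if_distrib[of "\<lambda>x. _ * x"] if_distrib[of Re] if_distrib[of Im] cong: if_cong)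
  have Du: "D u = (\<Sum>j\<in>UNIV. Re (u $ j) * D (axis j 1) + Im (u $ j) * D (axis j \<i>))" for u
    by (subst rep) (simp add: sum add scale)
  have "(of_real (D v) - \<i> * of_real (D (\<i> *s v))) / 2
     = (\<Sum>j\<in>UNIV. (of_real (Re (v $ j) * D (axis j 1) + Im (v $ j) * D (axis j \<i>))
          - \<i> * of_real (Re ((\<i> *s v) $ j) * D (axis j 1) + Im ((\<i> *s v) $ j) * D (axis j \<i>))) / 2)"
    unfolding Du[of v] Du[of "\<i> *s v"] by (simp only: of_real_sum sum_distrib_left sum_divide_distrib flip: sum_subtractf)
  also have "\<dots> = row_times_column (wirtinger_row \<rho> z) v"
    unfolding row_times_column_def wirtinger_row_def
    by (intro sum.cong refl) (simp add: dir complex_eq_iff algebra_simps add_divide_distrib diff_divide_distrib)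
  finally show ?thesis ..
qed

text \<open>Homogeneity determines \<open>D\<close> on the complex line of \<open>z\<close>: moving
  radially gives \<open>D z = \<rho> z\<close>, and moving in direction \<open>\<i> *s z\<close>
  changes the modulus only to second order, so \<open>D\<close> vanishes there.\<close>

lemma wirtinger_row_euler:
  fixes \<rho> :: "complex ^ 'n \<Rightarrow> real"
  assumes D: "(\<rho> has_derivative D) (at z)" and hom: "\<And>t z. \<rho> (t *s z) = cmod t * \<rho> z"
  shows "row_times_column (wirtinger_row \<rho> z) z = of_real (\<rho> z) / 2"
proof -
  have line: "((\<lambda>t::real. cmod (1 + of_real t * c) * \<rho> z) has_real_derivative D (c *s z)) (at 0)" for c
  proof -
    have "((\<lambda>t::real. z + t *\<^sub>R (c *s z)) has_derivative (\<lambda>t. t *\<^sub>R (c *s z))) (at 0)"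
      by (auto intro!: derivative_eq_intros)
    from has_derivative_compose[OF this, of \<rho> D]
    have "((\<lambda>t::real. \<rho> (z + t *\<^sub>R (c *s z))) has_derivative (\<lambda>t. D (t *\<^sub>R (c *s z)))) (at 0)"
      using D by simp
    moreover have "\<rho> (z + t *\<^sub>R (c *s z)) = cmod (1 + of_real t * c) * \<rho> z" for t
      unfolding hom[symmetric]
      by (rule arg_cong[of _ _ \<rho>]) (simp add: scaleR_eq_vector_smult vec_eq_iff algebra_simps)
    ultimately show ?thesis
      by (simp only: has_field_derivative_def linear_scale[OF has_derivative_linear[OF D]])
        (simp add: mult_commute_abs)
  qed
  have 1: "D z = \<rho> z"
  proof (rule DERIV_unique)
    show "((\<lambda>t::real. cmod (1 + of_real t * 1) * \<rho> z) has_real_derivative D z) (at 0)"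
      using line[of 1] by simp
    have "((\<lambda>t. (1 + t) * \<rho> z) has_real_derivative \<rho> z) (at 0)"
      by (auto intro!: derivative_eq_intros)
    then show "((\<lambda>t::real. cmod (1 + of_real t * 1) * \<rho> z) has_real_derivative \<rho> z) (at 0)"
    proof (rule has_field_derivative_transform_within_open[where S = "{-1<..}"])
      fix t :: real assume "t \<in> {-1<..}"
      then have "cmod (of_real (1 + t)) = 1 + t" by (subst norm_of_real) simp
      then show "(1 + t) * \<rho> z = cmod (1 + of_real t * 1) * \<rho> z" by simp
    qed auto
  qed
  have 2: "D (\<i> *s z) = 0"
  proof (rule DERIV_unique[OF line])
    have "((\<lambda>t. sqrt (1 + t\<^sup>2) * \<rho> z) has_real_derivative 0) (at 0)"
      by (auto intro!: derivative_eq_intros)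
    then show "((\<lambda>t::real. cmod (1 + of_real t * \<i>) * \<rho> z) has_real_derivative 0) (at 0)"
      by (simp add: cmod_def)
  qed
  show ?thesis
    by (simp add: row_times_column_wirtinger_row[OF D] 1 2)
qed

lemma minkowski_functional_ofD:
  assumes "minkowski_functional_of \<rho> \<Omega>"
  shows "0 \<le> \<rho> z" and "\<rho> z = 0 \<longleftrightarrow> z = 0" and "\<rho> (t *s z) = cmod t * \<rho> z" and "\<Omega> = {z. \<rho> z < 1}"
    and "continuous_on UNIV \<rho>"
  using assms unfolding minkowski_functional_of_def by blast+

section \<open>Restriction to the disc through a point\<close>

text \<open>Rescaling the disc by \<open>s = \<rho> z\<close> turns the derivative of order
  \<open>k\<close> of \<open>K\<close> into that of \<open>h\<close> times \<open>s ^ k / s\<close>;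
  Euler's identity supplies \<open>s / 2\<close>, and the normalization in the definitions cancels
  both. Starlikeness does not enter, so the extremal mapping can be evaluated by the same
  formulas.\<close>

lemma coefficients_along_disc:
  fixes \<rho> :: "complex ^ 'n \<Rightarrow> real"
  assumes \<rho>: "minkowski_functional_of \<rho> \<Omega>" and f: "holomorphic_fun_on f \<Omega>"
    and z: "z \<noteq> 0" and D: "(\<rho> has_derivative D) (at z)"
  defines "F \<equiv> \<lambda>z. f z *s z" and "h \<equiv> \<lambda>\<zeta>. \<zeta> * f (\<zeta> *s (of_real (1 / \<rho> z) *s z))"
  shows "h holomorphic_on ball 0 1"
    and "A2 \<rho> F z = (deriv ^^ 2) h 0 / fact 2" and "A3 \<rho> F z = (deriv ^^ 3) h 0 / fact 3"
    and "A4 \<rho> F z = (deriv ^^ 4) h 0 / fact 4"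
proof -
  note hom = minkowski_functional_ofD(3)[OF \<rho>] and pos = minkowski_functional_ofD(1,2)[OF \<rho>]
    and \<Omega> = minkowski_functional_ofD(4)[OF \<rho>]
  define s where "s = \<rho> z"
  have s: "s > 0" using pos[of z] z by (simp add: s_def less_le)
  define z0 where "z0 = of_real (1 / s) *s z"
  have "\<rho> z0 = 1" using s by (simp add: z0_def hom norm_divide flip: s_def)
  then have "\<zeta> *s z0 \<in> \<Omega>" if "\<zeta> \<in> ball 0 1" for \<zeta>
    using that by (simp add: \<Omega> hom)
  then have "(\<lambda>\<zeta>. f (\<zeta> *s z0)) holomorphic_on ball 0 1"
    using holomorphic_fun_on_line_holomorphic[OF f, of "ball 0 1" 0 z0] by simp
  then show h: "h holomorphic_on ball 0 1"
    unfolding h_def s_def[symmetric] z0_def[symmetric] by (intro holomorphic_intros)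
  define K where "K = (\<lambda>\<zeta>. \<zeta> * f (\<zeta> *s z))"
  have Kh: "K = (\<lambda>\<zeta>. of_real (1 / s) * h (of_real s * \<zeta>))"
    using s by (auto simp: K_def h_def s_def[symmetric] vector_smult_assoc)
  have S: "of_real s * \<zeta> \<in> ball 0 1" if "\<zeta> \<in> ball 0 (1 / s)" for \<zeta> :: complex
    using that s by (simp add: norm_mult field_simps)
  have K: "(deriv ^^ k) K 0 = of_real (1 / s) * (of_real s ^ k * (deriv ^^ k) h 0)" for k
  proof -
    have "(\<lambda>\<zeta>. h (of_real s * \<zeta>)) holomorphic_on ball 0 (1 / s)"
      using S by (intro holomorphic_on_compose_gen[OF _ h, unfolded o_def] holomorphic_intros) auto
    then have "(deriv ^^ k) K 0 = of_real (1 / s) * (deriv ^^ k) (\<lambda>\<zeta>. h (of_real s * \<zeta>)) 0"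
      unfolding Kh using s by (intro higher_deriv_cmult[where A = "ball 0 (1 / s)"]) auto
    also have "(deriv ^^ k) (\<lambda>\<zeta>. h (of_real s * \<zeta>)) 0 = of_real s ^ k * (deriv ^^ k) h (of_real s * 0)"
      using s S by (intro higher_deriv_compose_linear[OF h, where S = "ball 0 (1 / s)"]) auto
    finally show ?thesis by simp
  qed
  have "0 \<in> \<Omega>" using pos(2)[of 0] by (simp add: \<Omega>)
  note P = Frechet_powers_line[OF f this, of z, folded F_def K_def]
  have row: "row_times_column (wirtinger_row \<rho> z) (c *s z) = c * of_real s / 2" for c
    using wirtinger_row_euler[OF D hom]
    by (simp add: row_times_column_def s_def sum_distrib_left[symmetric] mult.left_commute)
  have quot: "2 * (of_real (1 / s) * (of_real s ^ k * a) * of_real s / 2) / (fact k * of_real s ^ k)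
     = a / fact k" for a :: complex and k
    using s by (simp add: field_simps)
  show "A2 \<rho> F z = (deriv ^^ 2) h 0 / fact 2"
    unfolding A2_def P row K s_def[symmetric] by (rule quot)
  show "A3 \<rho> F z = (deriv ^^ 3) h 0 / fact 3"
    unfolding A3_def P row K s_def[symmetric] by (rule quot)
  show "A4 \<rho> F z = (deriv ^^ 4) h 0 / fact 4"
    unfolding A4_def P row K s_def[symmetric] by (rule quot)
qed

text \<open>\<open>F\<close> multiplies each vector by a scalar and so maps the complex line of
  \<open>z0\<close> into itself, acting there as \<open>h\<close>. Injectivity restricts at once;
  for starlikeness the preimage of a point of the line must be shown to lie on the line.\<close>

lemma starlike_along_disc:
  fixes f :: "complex ^ 'n \<Rightarrow> complex"
  assumes f: "holomorphic_fun_on f \<Omega>" and f0: "f 0 = 1"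
    and F: "(\<lambda>z. f z *s z) \<in> normalized_starlike_maps \<Omega>"
    and z0: "z0 \<noteq> 0" "\<And>\<zeta>. \<zeta> *s z0 \<in> \<Omega> \<longleftrightarrow> \<zeta> \<in> ball 0 1"
  defines "h \<equiv> \<lambda>\<zeta>. \<zeta> * f (\<zeta> *s z0)"
  shows "inj_on h (ball 0 1)" and "deriv h 0 = 1" and "starlike_wrt_origin (h ` ball 0 1)"
proof -
  define F where "F = (\<lambda>z. f z *s z)"
  have inj: "inj_on F \<Omega>" and star: "starlike_wrt_origin (F ` \<Omega>)"
    using F unfolding normalized_starlike_maps_def biholomorphic_on_def F_def by auto
  have Fh: "F (\<zeta> *s z0) = h \<zeta> *s z0" for \<zeta>
    by (simp add: F_def h_def vector_smult_assoc mult.commute)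
  show inj_h: "inj_on h (ball 0 1)"
  proof (rule inj_onI)
    fix x y assume *: "x \<in> ball 0 1" "y \<in> ball 0 1" "h x = h y"
    then have "F (x *s z0) = F (y *s z0)" by (simp add: Fh)
    then have "x *s z0 = y *s z0"
      using inj_onD[OF inj] * z0(2) by blast
    then show "x = y" using z0(1) by simp
  qed
  have "((\<lambda>\<zeta>. f (0 + \<zeta> *s z0)) has_field_derivative frechet_derivative f (at (0 + 0 *s z0)) z0) (at 0)"
    using z0(2)[of 0] by (intro holomorphic_fun_on_line[OF f]) auto
  then show "deriv h 0 = 1"
    unfolding h_def by (intro DERIV_imp_deriv) (auto intro!: derivative_eq_intros simp: f0)
  show "starlike_wrt_origin (h ` ball 0 1)"
    unfolding starlike_wrt_origin_def
  proof (intro ballI)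
    fix w and t :: real assume "w \<in> h ` ball 0 1" and t: "t \<in> {0..1}"
    then obtain \<zeta> where \<zeta>: "\<zeta> \<in> ball 0 1" "w = h \<zeta>" by blast
    have "F (\<zeta> *s z0) \<in> F ` \<Omega>" using \<zeta>(1) z0(2) by blast
    then have "t *\<^sub>R F (\<zeta> *s z0) \<in> F ` \<Omega>"
      using star t unfolding starlike_wrt_origin_def by blast
    then obtain v where v: "v \<in> \<Omega>" "F v = (t *\<^sub>R w) *s z0"
      by (auto simp: Fh \<zeta>(2) scaleR_eq_vector_smult vector_smult_assoc scaleR_conv_of_real)
    show "t *\<^sub>R w \<in> h ` ball 0 1"
    proof (cases "t *\<^sub>R w = 0")
      case True
      have "h 0 = 0" by (simp add: h_def)
      with True show ?thesis by (metis centre_in_ball image_eqI zero_less_one)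
    next
      case False
      \<comment> \<open>Then \<open>v\<close> is the multiple \<open>1 / f v\<close> of
        \<open>F v\<close>, which lies on the line.\<close>
      have "f v \<noteq> 0" using v(2) False z0(1) by (auto simp: F_def)
      define \<zeta>' where "\<zeta>' = of_real t * w / f v"
      have "v = \<zeta>' *s z0"
      proof -
        have "(1 / f v) *s F v = (1 / f v) *s ((t *\<^sub>R w) *s z0)" using v(2) by simp
        then show ?thesis using \<open>f v \<noteq> 0\<close> by (simp add: F_def vector_smult_assoc \<zeta>'_def scaleR_conv_of_real)
      qed
      then have "\<zeta>' \<in> ball 0 1" "h \<zeta>' *s z0 = (t *\<^sub>R w) *s z0"
        using v z0(2) Fh by auto
      then show ?thesis using z0(1) by force
    qed
  qed
qed

lemma starlike_map_bound:
  fixes \<rho> :: "complex ^ 'n \<Rightarrow> real"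
  assumes \<rho>: "minkowski_functional_of \<rho> \<Omega>" and f: "holomorphic_fun_on f \<Omega>" and f0: "f 0 = 1"
    and F: "F = (\<lambda>z. f z *s z)" "F \<in> normalized_starlike_maps \<Omega>"
    and z: "z \<noteq> 0" and D: "(\<rho> has_derivative D) (at z)"
  shows "cmod ((A2 \<rho> F z - A4 \<rho> F z) *
                ((A2 \<rho> F z)\<^sup>2 - 2 * (A3 \<rho> F z)\<^sup>2 + A2 \<rho> F z * A4 \<rho> F z)) \<le> 84"
proof -
  note hom = minkowski_functional_ofD(3)[OF \<rho>] and pos = minkowski_functional_ofD(1,2)[OF \<rho>]
    and \<Omega> = minkowski_functional_ofD(4)[OF \<rho>]
  define z0 where "z0 = of_real (1 / \<rho> z) *s z"
  have "\<rho> z > 0" using pos[of z] z by (simp add: less_le)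
  then have "\<rho> z0 = 1" by (simp add: z0_def hom norm_divide)
  then have z0: "z0 \<noteq> 0" "\<zeta> *s z0 \<in> \<Omega> \<longleftrightarrow> \<zeta> \<in> ball 0 1" for \<zeta>
    using pos(2)[of z0] by (auto simp: \<Omega> hom)
  note c = coefficients_along_disc[OF \<rho> f z D, folded F(1) z0_def]
  note s = starlike_along_disc[OF f f0 F(2)[unfolded F(1)] z0]
  show ?thesis
    unfolding c by (rule starlike_toeplitz_bound[OF c(1) s(1) _ s(2,3)]) simp
qed

section \<open>The extremal Koebe mapping\<close>

definition koebe :: "complex \<Rightarrow> complex" where
  "koebe \<zeta> = \<zeta> / (1 - \<zeta>)\<^sup>2"

text \<open>Solves \<open>1 + 4 * koebe \<zeta> = ((1 + \<zeta>) / (1 - \<zeta>))\<^sup>2\<close>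
  for \<zeta>: the principal root selects the right half plane, which the Cayley transform
  \<open>(m - 1) / (m + 1)\<close> takes to the disc.\<close>

definition koebe_inv :: "complex \<Rightarrow> complex" where
  "koebe_inv s = (csqrt (1 + 4 * s) - 1) / (csqrt (1 + 4 * s) + 1)"

text \<open>The plane slit along the real ray from -1/4 to minus infinity.\<close>

definition koebe_range :: "complex set" where
  "koebe_range = {s. 1 + 4 * s \<notin> \<real>\<^sub>\<le>\<^sub>0}"

lemma open_koebe_range: "open koebe_range"
proof -
  have "open ((\<lambda>s::complex. 1 + 4 * s) -` (- \<real>\<^sub>\<le>\<^sub>0))"
    by (intro open_vimage continuous_intros) (auto intro: closed_nonpos_Reals_complex)
  then show ?thesis by (simp add: koebe_range_def vimage_def)
qed

lemma Re_csqrt_pos: "w \<notin> \<real>\<^sub>\<le>\<^sub>0 \<Longrightarrow> 0 < Re (csqrt w)"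
proof (rule ccontr)
  assume w: "w \<notin> \<real>\<^sub>\<le>\<^sub>0" and "\<not> 0 < Re (csqrt w)"
  then have "Re (csqrt w) = 0"
    using csqrt_principal[of w] by auto
  then have "w = of_real (- (Im (csqrt w))\<^sup>2)"
    by (subst power2_csqrt[of w, symmetric]) (simp add: complex_eq_iff power2_eq_square)
  then show False using w by (metis neg_le_0_iff_le nonpos_Reals_of_real_iff zero_le_power2)
qed

lemma koebe_inv:
  assumes "s \<in> koebe_range"
  shows "koebe_inv s \<in> ball 0 1" and "koebe (koebe_inv s) = s"
proof -
  define m where "m = csqrt (1 + 4 * s)"
  have m: "0 < Re m"
    unfolding m_def using assms by (intro Re_csqrt_pos) (simp add: koebe_range_def)
  have m1: "m + 1 \<noteq> 0" using m by (auto simp: complex_eq_iff)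
  \<comment> \<open>A point of the right half plane is closer to 1 than to -1.\<close>
  have "(cmod (m - 1))\<^sup>2 < (cmod (m + 1))\<^sup>2"
    using m by (simp only: cmod_power2) (simp add: power2_eq_square algebra_simps)
  then have "cmod (m - 1) < cmod (m + 1)" by (rule power2_less_imp_less) simp
  then show "koebe_inv s \<in> ball 0 1"
    using m1 by (simp add: koebe_inv_def norm_divide flip: m_def)
  have inv: "koebe_inv s = (m - 1) / (m + 1)" by (simp add: koebe_inv_def m_def)
  have "1 - (m - 1) / (m + 1) = 2 / (m + 1)"
    using m1 by (simp add: field_simps)
  then have "koebe (koebe_inv s) = (m - 1) / (m + 1) / (2 / (m + 1))\<^sup>2"
    by (simp only: koebe_def inv)
  also have "\<dots> = (m - 1) * (m + 1) / 4"
    using m1 by (simp add: power_divide power2_eq_square)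
  also have "\<dots> = (m\<^sup>2 - 1) / 4"
    by (simp add: power2_eq_square algebra_simps)
  finally show "koebe (koebe_inv s) = s" by (simp add: m_def)
qed

lemma koebe:
  assumes "\<zeta> \<in> ball 0 1"
  shows "koebe \<zeta> \<in> koebe_range" and "koebe_inv (koebe \<zeta>) = \<zeta>"
proof -
  define m where "m = (1 + \<zeta>) / (1 - \<zeta>)"
  have z1: "1 - \<zeta> \<noteq> 0" using assms by auto
  have "Re ((1 + \<zeta>) * cnj (1 - \<zeta>)) = 1 - (cmod \<zeta>)\<^sup>2"
    by (simp only: cmod_power2) (simp add: power2_eq_square algebra_simps)
  moreover have "(cmod \<zeta>)\<^sup>2 < 1" using assms by (simp add: power_less_one_iff abs_square_less_1)
  ultimately have "0 < Re ((1 + \<zeta>) * cnj (1 - \<zeta>))" by simp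
  then have m: "0 < Re m"
    using z1 by (simp only: m_def complex_div_cnj[of "1 + \<zeta>" "1 - \<zeta>"] Re_divide_of_real
        of_real_power[symmetric]) simp
  have "1 + 4 * koebe \<zeta> = ((1 - \<zeta>)\<^sup>2 + 4 * \<zeta>) / (1 - \<zeta>)\<^sup>2"
    using z1 by (simp add: koebe_def add_divide_distrib)
  also have "(1 - \<zeta>)\<^sup>2 + 4 * \<zeta> = (1 + \<zeta>)\<^sup>2"
    by (simp add: power2_eq_square algebra_simps)
  finally have sq: "1 + 4 * koebe \<zeta> = m\<^sup>2"
    by (simp add: m_def power_divide)
  have "m\<^sup>2 \<notin> \<real>\<^sub>\<le>\<^sub>0"
    using m by (auto simp: complex_nonpos_Reals_iff power2_eq_square not_le)
  then show "koebe \<zeta> \<in> koebe_range" by (simp add: koebe_range_def sq)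
  have "csqrt (m\<^sup>2) = m" using m by (intro csqrt_square) auto
  then have "koebe_inv (koebe \<zeta>) = (m - 1) / (m + 1)"
    by (simp add: koebe_inv_def sq)
  also have "m - 1 = 2 * \<zeta> / (1 - \<zeta>)"
    using z1 by (simp add: m_def field_simps)
  also have "m + 1 = 2 / (1 - \<zeta>)"
    using z1 by (simp add: m_def field_simps)
  finally show "koebe_inv (koebe \<zeta>) = \<zeta>" using z1 by simp
qed

lemma koebe_image: "koebe ` ball 0 1 = koebe_range"
proof
  show "koebe ` ball 0 1 \<subseteq> koebe_range" using koebe(1) by blast
  show "koebe_range \<subseteq> koebe ` ball 0 1"
    using koebe_inv by (metis image_eqI subsetI)
qed

lemma koebe_inj: "inj_on koebe (ball 0 1)"
  using koebe(2) by (rule inj_on_inverseI)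

lemma koebe_holomorphic: "koebe holomorphic_on ball 0 1"
  unfolding koebe_def by (auto intro!: holomorphic_intros)

lemma koebe_inv_holomorphic: "koebe_inv holomorphic_on koebe_range"
proof -
  have "csqrt (1 + 4 * s) + 1 \<noteq> 0" if "s \<in> koebe_range" for s
  proof
    assume "csqrt (1 + 4 * s) + 1 = 0"
    then have "csqrt (1 + 4 * s) = - 1" by (simp add: eq_neg_iff_add_eq_0)
    moreover have "0 < Re (csqrt (1 + 4 * s))"
      using that by (intro Re_csqrt_pos) (simp add: koebe_range_def)
    ultimately show False by (simp only:) simp
  qed
  then show ?thesis
    unfolding koebe_inv_def by (auto intro!: holomorphic_intros simp: koebe_range_def)
qed

lemma koebe_range_starlike:
  assumes "s \<in> koebe_range" "t \<in> {0..1::real}"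
  shows "of_real t * s \<in> koebe_range"
proof (rule ccontr)
  assume "of_real t * s \<notin> koebe_range"
  then have im: "t * Im s = 0" and re: "1 + 4 * (t * Re s) \<le> 0"
    by (auto simp: koebe_range_def complex_nonpos_Reals_iff)
  have "t \<noteq> 0" using re by auto
  then have "Im s = 0" using im by simp
  moreover have "1 + 4 * Re s \<le> 0"
  proof -
    \<comment> \<open>Uses \<open>t \<le> 1\<close>: if the shrunken point were on the slit, then so
      would be \<open>s\<close>.\<close>
    have "t * (1 + 4 * Re s) \<le> 1 + 4 * (t * Re s)" using assms(2) by (simp add: algebra_simps)
    then have "t * (1 + 4 * Re s) \<le> 0" using re by linarith
    then show ?thesis using \<open>t \<noteq> 0\<close> assms(2) by (simp add: mult_le_0_iff)
  qed
  ultimately show False using assms(1) by (simp add: koebe_range_def complex_nonpos_Reals_iff)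
qed

lemma koebe_starlike: "starlike_wrt_origin (koebe ` ball 0 1)"
  unfolding koebe_image starlike_wrt_origin_def
  using koebe_range_starlike by (simp add: scaleR_conv_of_real)

text \<open>Two multiplications by \<open>L\<close> reduce the series \<open>P\<close> first to the
  geometric series and then to 1, so \<open>P\<close> is the inverse of \<open>L\<^sup>2\<close>;
  the extra factor \<zeta> shifts the index by one.\<close>

lemma koebe_expansion:
  fixes q :: complex
  shows "(deriv ^^ Suc n) (\<lambda>\<zeta>. \<zeta> * (1 / (1 - q * \<zeta>)\<^sup>2)) 0 / fact (Suc n) = of_nat (Suc n) * q ^ n"
proof -
  define P where "P = Abs_fps (\<lambda>n. of_nat (Suc n) * q ^ n)"
  define L where "L = 1 - fps_const q * fps_X"
  have mult_L: "fps_nth (A * L) n = fps_nth A n - (if n = 0 then 0 else fps_nth A (n - 1) * q)" for A n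
    by (simp add: L_def right_diff_distrib mult.assoc[symmetric])
  have PL: "P * L = Abs_fps (\<lambda>n. q ^ n)"
  proof (rule fps_ext)
    show "fps_nth (P * L) n = fps_nth (Abs_fps (\<lambda>n. q ^ n)) n" for n
      unfolding mult_L by (cases n) (simp_all add: P_def algebra_simps)
  qed
  have "P * L\<^sup>2 = P * L * L" by (simp add: power2_eq_square mult.assoc)
  also have "\<dots> = 1"
  proof (rule fps_ext)
    show "fps_nth (P * L * L) n = fps_nth 1 n" for n
      unfolding PL mult_L by (cases n) simp_all
  qed
  finally have "inverse (L\<^sup>2) = P"
    by (intro fps_inverse_unique) (simp add: mult.commute)
  moreover have "(\<lambda>\<zeta>. \<zeta> * inverse ((1 - q * \<zeta>)\<^sup>2)) has_fps_expansion fps_X * inverse (L\<^sup>2)"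
    unfolding L_def by (intro fps_expansion_intros) (simp add: fps_nth_power_0)
  ultimately have "(\<lambda>\<zeta>. \<zeta> * inverse ((1 - q * \<zeta>)\<^sup>2)) has_fps_expansion fps_X * P"
    by simp
  from fps_nth_fps_expansion[OF this, of "Suc n"] show ?thesis
    by (simp add: P_def inverse_eq_divide)
qed

section \<open>The Koebe mapping on the domain\<close>

lemma holomorphic_fun_on_coordinate:
  fixes U :: "(complex ^ 'n) set"
  assumes q: "q holomorphic_on T" "open T" and U: "open U" "\<And>w. w \<in> U \<Longrightarrow> w $ j * c \<in> T"
  shows "holomorphic_fun_on (\<lambda>w. q (w $ j * c)) U"
  unfolding holomorphic_fun_on_def
proof (intro conjI ballI)
  fix w assume "w \<in> U"
  then have "(q has_field_derivative deriv q (w $ j * c)) (at (w $ j * c))"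
    using q U(2) by (intro holomorphic_derivI) auto
  then have q': "(q has_derivative (\<lambda>h. deriv q (w $ j * c) * h)) (at (w $ j * c))"
    by (simp add: has_field_derivative_def)
  have "((\<lambda>w. w $ j * c) has_derivative (\<lambda>h. h $ j * c)) (at w)"
    by (auto intro!: bounded_linear_imp_has_derivative bounded_linear_mult_const bounded_linear_vec_nth)
  from has_derivative_compose[OF this q']
  show "\<exists>f'. ((\<lambda>w. q (w $ j * c)) has_derivative f') (at w) \<and> (\<forall>c v. f' (c *s v) = c * f' v)"
    by (rule exI[of _ "\<lambda>h. deriv q (w $ j * c) * (h $ j * c)", OF conjI]) simp
qed fact

lemma holomorphic_map_on_smult:
  assumes f: "holomorphic_fun_on f U"
  shows "z \<in> U \<Longrightarrow> ((\<lambda>z. f z *s z) has_derivative (\<lambda>h. f z *s h + frechet_derivative f (at z) h *s z)) (at z)"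
    and "holomorphic_map_on (\<lambda>z. f z *s z) U"
proof -
  show *: "((\<lambda>z. f z *s z) has_derivative (\<lambda>h. f z *s h + frechet_derivative f (at z) h *s z)) (at z)"
    if "z \<in> U" for z
    by (rule bounded_bilinear.FDERIV[OF bounded_bilinear_vector_smult holomorphic_fun_on_frechet(1)[OF f that]
          has_derivative_ident])
  have "f z *s (c *s v) + frechet_derivative f (at z) (c *s v) *s z
      = c *s (f z *s v + frechet_derivative f (at z) v *s z)" if "z \<in> U" for z c v
    by (simp add: holomorphic_fun_on_frechet(2)[OF f that] vec_eq_iff algebra_simps)
  with * f show "holomorphic_map_on (\<lambda>z. f z *s z) U"
    unfolding holomorphic_map_on_def holomorphic_fun_on_def by blast
qed

lemma holomorphic_map_on_cong:
  assumes "holomorphic_map_on G V" "\<And>w. w \<in> V \<Longrightarrow> G w = H w"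
  shows "holomorphic_map_on H V"
  unfolding holomorphic_map_on_def
proof (intro conjI ballI)
  show V: "open V" using assms(1) by (simp add: holomorphic_map_on_def)
  fix z assume z: "z \<in> V"
  then obtain F' where F': "(G has_derivative F') (at z)" "\<forall>c v. F' (c *s v) = c *s F' v"
    using assms(1) unfolding holomorphic_map_on_def by blast
  have "(H has_derivative F') (at z)"
    using has_derivative_transform_within_open[OF F'(1) V z] assms(2) by blast
  with F'(2) show "\<exists>F'. (H has_derivative F') (at z) \<and> (\<forall>c v. F' (c *s v) = c *s F' v)" by blast
qed

text \<open>The scaled coordinate \<open>j\<close> of \<open>F z\<close> is the Koebe function of
  that of \<open>z\<close>, so the scalar factor can be recovered from the image and
  \<open>F\<close> has an explicit holomorphic inverse \<open>G\<close>. For starlikeness,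
  \<open>G (t *\<^sub>R F z)\<close> is a multiple \<open>u *s z\<close> with
  \<open>cmod u \<le> 1\<close>, which homogeneity of \<open>\<rho>\<close> keeps in the
  domain.\<close>

lemma koebe_map_normalized_starlike:
  fixes \<Omega> :: "(complex ^ 'n) set" and j :: 'n
  assumes \<rho>: "minkowski_functional_of \<rho> \<Omega>" and \<Omega>: "open \<Omega>" "connected \<Omega>"
    and c: "\<And>z. z \<in> \<Omega> \<Longrightarrow> cmod (z $ j * c) < 1"
  defines "f \<equiv> \<lambda>z. 1 / (1 - z $ j * c)\<^sup>2"
  shows "holomorphic_fun_on f \<Omega>" and "(\<lambda>z. f z *s z) \<in> normalized_starlike_maps \<Omega>"
proof -
  note hom = minkowski_functional_ofD(3)[OF \<rho>] and pos = minkowski_functional_ofD(1,2)[OF \<rho>]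
    and \<Omega>_eq = minkowski_functional_ofD(4)[OF \<rho>]
  define F where "F = (\<lambda>z. f z *s z)"
  have c_ball: "z $ j * c \<in> ball 0 1" and c_ne: "1 - z $ j * c \<noteq> 0" if "z \<in> \<Omega>" for z
    using c[OF that] by auto
  show f: "holomorphic_fun_on f \<Omega>"
    unfolding f_def
    by (rule holomorphic_fun_on_coordinate[of "\<lambda>\<zeta>. 1 / (1 - \<zeta>)\<^sup>2" "ball 0 1"])
      (use c_ball \<Omega> in \<open>auto intro!: holomorphic_intros\<close>)
  have "0 \<in> \<Omega>" using pos(2)[of 0] by (simp add: \<Omega>_eq)
  have F: "holomorphic_map_on F \<Omega>"
    unfolding F_def by (rule holomorphic_map_on_smult(2)[OF f])
  have Fj: "F z $ j * c = koebe (z $ j * c)" for z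
    by (simp add: F_def f_def koebe_def)
  define g where "g w = (1 - koebe_inv (w $ j * c))\<^sup>2" for w :: "complex ^ 'n"
  define G where "G w = g w *s w" for w
  have GF: "G (F z) = z" if "z \<in> \<Omega>" for z
    using c_ne[OF that] unfolding G_def g_def Fj koebe(2)[OF c_ball[OF that]]
    by (simp add: F_def f_def vector_smult_assoc)
  have FG: "F (G w) = w" "G w $ j * c = koebe_inv (w $ j * c)" if "w $ j * c \<in> koebe_range" for w
  proof -
    define \<zeta> where "\<zeta> = koebe_inv (w $ j * c)"
    have \<zeta>: "\<zeta> \<in> ball 0 1" "koebe \<zeta> = w $ j * c" using koebe_inv[OF that] by (auto simp: \<zeta>_def)
    have ne: "1 - \<zeta> \<noteq> 0" using \<zeta>(1) by auto
    have "G w $ j * c = (1 - \<zeta>)\<^sup>2 * (w $ j * c)" by (simp add: G_def g_def flip: \<zeta>_def)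
    also have "\<dots> = \<zeta>" using ne by (simp add: koebe_def flip: \<zeta>(2))
    finally show *: "G w $ j * c = koebe_inv (w $ j * c)" by (simp add: \<zeta>_def)
    show "F (G w) = w"
      unfolding F_def f_def * using ne by (simp add: G_def g_def vector_smult_assoc flip: \<zeta>_def)
  qed
  define V where "V = {w :: complex ^ 'n. w $ j * c \<in> koebe_range}"
  have "open ((\<lambda>w :: complex ^ 'n. w $ j * c) -` koebe_range)"
    by (intro open_vimage open_koebe_range continuous_intros)
  then have V: "open V" by (simp add: V_def vimage_def)
  have "(\<lambda>\<zeta>. (1 - koebe_inv \<zeta>)\<^sup>2) holomorphic_on koebe_range"
    by (intro holomorphic_intros koebe_inv_holomorphic)
  then have g: "holomorphic_fun_on g V"
    unfolding g_def
    by (intro holomorphic_fun_on_coordinate[of "\<lambda>\<zeta>. (1 - koebe_inv \<zeta>)\<^sup>2" koebe_range] open_koebe_range V)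
      (simp_all add: V_def)
  note G = holomorphic_map_on_smult[OF g, folded G_def]
  have cont_G: "continuous_on V G"
    using has_derivative_continuous[OF G(1)] continuous_at_imp_continuous_on by blast
  \<comment> \<open>Describing the image as a preimage under the continuous \<open>G\<close> gives
    its openness and a membership test for starlikeness.\<close>
  have image: "F ` \<Omega> = V \<inter> G -` \<Omega>"
  proof
    show "F ` \<Omega> \<subseteq> V \<inter> G -` \<Omega>"
      using koebe(1)[OF c_ball] by (auto simp: V_def Fj GF)
    show "V \<inter> G -` \<Omega> \<subseteq> F ` \<Omega>"
      using FG(1) by (force simp: V_def)
  qed
  have open_image: "open (F ` \<Omega>)"
    unfolding image by (rule continuous_open_preimage[OF cont_G V \<Omega>(1)])
  have "continuous_on \<Omega> F"
    using has_derivative_continuous[OF holomorphic_map_on_smult(1)[OF f]] continuous_at_imp_continuous_on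
    unfolding F_def by blast
  then have conn: "connected (F ` \<Omega>)"
    using \<Omega>(2) by (rule connected_continuous_image)
  have inj: "inj_on F \<Omega>"
    using GF by (rule inj_on_inverseI)
  have "holomorphic_map_on G (F ` \<Omega>)"
    using G(2) open_image unfolding holomorphic_map_on_def image by blast
  then have "holomorphic_map_on (inv_into \<Omega> F) (F ` \<Omega>)"
    by (rule holomorphic_map_on_cong) (auto simp: inv_into_f_f[OF inj] GF)
  then have bihol: "biholomorphic_on F \<Omega>"
    unfolding biholomorphic_on_def using F inj open_image conn by blast
  have norm: "normalized_map F"
    using holomorphic_map_on_smult(1)[OF f \<open>0 \<in> \<Omega>\<close>] unfolding normalized_map_def F_def
    by (simp add: f_def)
  have "starlike_wrt_origin (F ` \<Omega>)"
    unfolding starlike_wrt_origin_def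
  proof (intro ballI)
    fix w and t :: real assume "w \<in> F ` \<Omega>" and t: "t \<in> {0..1}"
    then obtain z where z: "z \<in> \<Omega>" "w = F z" by blast
    define \<zeta> where "\<zeta> = z $ j * c"
    define \<zeta>' where "\<zeta>' = koebe_inv (of_real t * koebe \<zeta>)"
    have \<zeta>: "\<zeta> \<in> ball 0 1" using c_ball[OF z(1)] by (simp add: \<zeta>_def)
    have tr: "of_real t * koebe \<zeta> \<in> koebe_range"
      using koebe(1)[OF \<zeta>] t by (rule koebe_range_starlike)
    note \<zeta>' = koebe_inv[OF tr, folded \<zeta>'_def]
    have le: "cmod \<zeta>' \<le> cmod \<zeta>"
      by (rule starlike_inverse_norm_le[OF koebe_holomorphic koebe_inj _ koebe_starlike \<zeta> t \<zeta>'])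
        (simp add: koebe_def)
    have twj: "(t *\<^sub>R w) $ j * c = of_real t * koebe \<zeta>"
      by (simp add: z(2) \<zeta>_def scaleR_eq_vector_smult mult.assoc Fj)
    have ne: "1 - \<zeta> \<noteq> 0" "1 - \<zeta>' \<noteq> 0" using \<zeta> \<zeta>'(1) by auto
    define u where "u = of_real t * (1 - \<zeta>')\<^sup>2 / (1 - \<zeta>)\<^sup>2"
    have Gu: "G (t *\<^sub>R w) = u *s z"
      unfolding G_def g_def twj \<zeta>'_def[symmetric]
      by (simp add: z(2) F_def f_def scaleR_eq_vector_smult vector_smult_assoc u_def flip: \<zeta>_def)
    have "cmod u \<le> 1"
    \<comment> \<open>The identity \<open>u * \<zeta> = \<zeta>'\<close> and Schwarz' estimate bound
      \<open>u\<close> only off 0; at 0 the definition gives \<open>u = t\<close>.\<close>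
    proof (cases "\<zeta> = 0")
      case True
      then have "\<zeta>' = 0" using le by simp
      with True t show ?thesis by (simp add: u_def)
    next
      case False
      have "u * \<zeta> = (1 - \<zeta>')\<^sup>2 * (of_real t * koebe \<zeta>)" by (simp add: u_def koebe_def)
      also have "\<dots> = \<zeta>'" unfolding \<zeta>'(2)[symmetric] using ne by (simp add: koebe_def)
      finally have "cmod u * cmod \<zeta> \<le> 1 * cmod \<zeta>" using le by (metis norm_mult mult_1)
      then show ?thesis using False by simp
    qed
    then have "cmod u * \<rho> z \<le> 1 * \<rho> z" using pos(1) by (intro mult_right_mono)
    then have "G (t *\<^sub>R w) \<in> \<Omega>" using z(1) by (simp add: Gu hom \<Omega>_eq)
    then show "t *\<^sub>R w \<in> F ` \<Omega>"
      unfolding image using tr twj by (simp add: V_def)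
  qed
  with norm bihol show "(\<lambda>z. f z *s z) \<in> normalized_starlike_maps \<Omega>"
    unfolding normalized_starlike_maps_def F_def by blast
qed

text \<open>The unit sphere of \<open>\<rho>\<close> is compact, so the coordinate attains a maximal
  modulus \<open>r\<close> there; homogeneity extends the estimate to all \<open>z\<close>, and a
  rotation makes the coordinate of the maximizer real.\<close>

lemma exists_max_coordinate:
  fixes \<Omega> :: "(complex ^ 'n) set" and j :: 'n
  assumes \<rho>: "minkowski_functional_of \<rho> \<Omega>" and bd: "bounded \<Omega>"
  obtains r w where "r > 0" "\<And>z. cmod (z $ j) \<le> r * \<rho> z" "\<rho> w = 1" "w $ j = of_real r"
proof -
  note hom = minkowski_functional_ofD(3)[OF \<rho>] and pos = minkowski_functional_ofD(1,2)[OF \<rho>]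
    and \<Omega> = minkowski_functional_ofD(4)[OF \<rho>]
  define K where "K = {z. \<rho> z = 1}"
  \<comment> \<open>The sphere lies outside \<Omega>; halving moves it inside, where the bound on
    norms applies.\<close>
  have half: "\<rho> ((1 / 2) *s z) = \<rho> z / 2" for z by (simp add: hom)
  have "bounded K"
  proof -
    obtain B where B: "\<And>z. z \<in> \<Omega> \<Longrightarrow> norm z \<le> B" using bd bounded_iff by blast
    have "norm z \<le> 2 * B" if "z \<in> K" for z
    proof -
      have "(1 / 2) *s z \<in> \<Omega>" using that by (simp add: \<Omega> half K_def)
      then have "norm ((1 / 2) *s z) \<le> B" by (rule B)
      then show ?thesis by (simp add: norm_vector_smult_complex)
    qed
    then show ?thesis using bounded_iff by blast
  qed
  moreover have "closed K"
    unfolding K_def using minkowski_functional_ofD(5)[OF \<rho>]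
    by (intro closed_Collect_eq) auto
  ultimately have "compact K" by (simp add: compact_eq_bounded_closed)
  define a :: "complex ^ 'n" where "a = axis j 1"
  have "\<rho> a > 0" using pos[of a] by (simp add: less_le a_def axis_eq_0_iff)
  then have aK: "of_real (1 / \<rho> a) *s a \<in> K" by (simp add: K_def hom norm_divide)
  have "continuous_on K (\<lambda>z. cmod (z $ j))" by (intro continuous_intros)
  then obtain w where w: "w \<in> K" "\<And>z. z \<in> K \<Longrightarrow> cmod (z $ j) \<le> cmod (w $ j)"
    using continuous_attains_sup[OF \<open>compact K\<close>, of "\<lambda>z. cmod (z $ j)"] aK by blast
  define r where "r = cmod (w $ j)"
  have "0 < 1 / \<rho> a" using \<open>\<rho> a > 0\<close> by simp
  also have "\<dots> \<le> r"
    using w(2)[OF aK] \<open>\<rho> a > 0\<close> by (simp add: r_def a_def norm_divide)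
  finally have "r > 0" .
  moreover have "cmod (z $ j) \<le> r * \<rho> z" for z
  proof (cases "z = 0")
    case True
    then show ?thesis using pos(1) by (simp add: r_def)
  next
    case False
    then have "\<rho> z > 0" using pos[of z] by (simp add: less_le)
    then have "of_real (1 / \<rho> z) *s z \<in> K" by (simp add: K_def hom norm_divide)
    from w(2)[OF this] \<open>\<rho> z > 0\<close> show ?thesis by (simp add: r_def norm_divide field_simps)
  qed
  moreover define v where "v = (of_real r / w $ j) *s w"
  have "w $ j \<noteq> 0" using \<open>r > 0\<close> by (auto simp: r_def)
  then have "\<rho> v = 1" "v $ j = of_real r"
    using w(1) \<open>r > 0\<close> by (simp_all add: v_def hom norm_divide K_def flip: r_def)
  ultimately show ?thesis using that by blast
qed

section \<open>The sharp bound\<close>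

theorem theorem6:
  fixes \<Omega> E :: "(complex ^ 'n) set" and \<rho> :: "complex ^ 'n \<Rightarrow> real"
  assumes "bounded_starlike_circular_domain \<Omega>" and "0 \<in> \<Omega>"
    and "minkowski_functional_of \<rho> \<Omega>"
    and "exceptional_set E" and "C1_on \<rho> (UNIV - E)"
  shows "(\<forall>(f :: complex ^ 'n \<Rightarrow> complex) F.
            holomorphic_fun_on f \<Omega> \<and> f 0 = 1 \<and> F = (\<lambda>z. f z *s z) \<and>
            F \<in> normalized_starlike_maps \<Omega> \<longrightarrow>
            (\<forall>z \<in> \<Omega> - E.
               cmod ((A2 \<rho> F z - A4 \<rho> F z) *
                     ((A2 \<rho> F z)\<^sup>2 - 2 * (A3 \<rho> F z)\<^sup>2 + A2 \<rho> F z * A4 \<rho> F z)) \<le> 84))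
       \<and> (\<forall>C :: real.
            (\<forall>(f :: complex ^ 'n \<Rightarrow> complex) F.
               holomorphic_fun_on f \<Omega> \<and> f 0 = 1 \<and> F = (\<lambda>z. f z *s z) \<and>
               F \<in> normalized_starlike_maps \<Omega> \<longrightarrow>
               (\<forall>z \<in> \<Omega> - E.
                  cmod ((A2 \<rho> F z - A4 \<rho> F z) *
                        ((A2 \<rho> F z)\<^sup>2 - 2 * (A3 \<rho> F z)\<^sup>2 + A2 \<rho> F z * A4 \<rho> F z)) \<le> C))
            \<longrightarrow> 84 \<le> C)"
proof (intro conjI allI impI ballI; (elim conjE)?)
  note \<rho> = assms(3)
  note hom = minkowski_functional_ofD(3)[OF \<rho>] and pos = minkowski_functional_ofD(1,2)[OF \<rho>]
    and \<Omega>_eq = minkowski_functional_ofD(4)[OF \<rho>] and cont = minkowski_functional_ofD(5)[OF \<rho>]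
  have diff: "\<exists>D. (\<rho> has_derivative D) (at z)" if "z \<notin> E" for z
    using assms(5) that unfolding C1_on_def by blast
  {
    fix f :: "complex ^ 'n \<Rightarrow> complex" and F z
    assume f: "holomorphic_fun_on f \<Omega>" "f 0 = 1" and F: "F = (\<lambda>z. f z *s z)" "F \<in> normalized_starlike_maps \<Omega>"
      and z: "z \<in> \<Omega> - E"
    show "cmod ((A2 \<rho> F z - A4 \<rho> F z) *
                     ((A2 \<rho> F z)\<^sup>2 - 2 * (A3 \<rho> F z)\<^sup>2 + A2 \<rho> F z * A4 \<rho> F z)) \<le> 84"
    proof (cases "z = 0")
      case True
      \<comment> \<open>Division by zero yields 0, so \<open>A2\<close> and \<open>A4\<close> vanish
        at the origin and with them the first factor.\<close>
      then have "\<rho> z = 0" using pos(2) by blast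
      then show ?thesis by (simp add: A2_def A4_def)
    next
      case False
      obtain D where "(\<rho> has_derivative D) (at z)" using diff z by blast
      from starlike_map_bound[OF \<rho> f F False this] show ?thesis .
    qed
  next
    fix C :: real
    assume C: "\<forall>(f :: complex ^ 'n \<Rightarrow> complex) F.
               holomorphic_fun_on f \<Omega> \<and> f 0 = 1 \<and> F = (\<lambda>z. f z *s z) \<and>
               F \<in> normalized_starlike_maps \<Omega> \<longrightarrow>
               (\<forall>z \<in> \<Omega> - E.
                  cmod ((A2 \<rho> F z - A4 \<rho> F z) *
                        ((A2 \<rho> F z)\<^sup>2 - 2 * (A3 \<rho> F z)\<^sup>2 + A2 \<rho> F z * A4 \<rho> F z)) \<le> C)"
    have \<Omega>: "bounded \<Omega>" "open \<Omega>" "connected \<Omega>"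
      using assms(1) by (simp_all add: bounded_starlike_circular_domain_def)
    fix j :: 'n
    obtain r w where r: "r > 0" "\<And>z. cmod (z $ j) \<le> r * \<rho> z" and w: "\<rho> w = 1" "w $ j = of_real r"
      using exists_max_coordinate[OF \<rho> \<Omega>(1), of j] by metis
    define c :: complex where "c = of_real (1 / r)"
    have c: "cmod (z $ j * c) < 1" if "z \<in> \<Omega>" for z
    proof -
      have "r * \<rho> z < r * 1"
        using that r(1) by (intro mult_strict_left_mono) (auto simp: \<Omega>_eq)
      then have "cmod (z $ j) < r" using r(2)[of z] by simp
      then show ?thesis using r(1) by (simp add: c_def norm_mult norm_divide)
    qed
    define f where "f z = 1 / (1 - z $ j * c)\<^sup>2" for z :: "complex ^ 'n"
    define F where "F = (\<lambda>z. f z *s z)"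
    have f: "holomorphic_fun_on f \<Omega>" "F \<in> normalized_starlike_maps \<Omega>"
      using koebe_map_normalized_starlike[OF \<rho> \<Omega>(2,3) c] by (simp_all add: f_def[abs_def] F_def)
    \<comment> \<open>On the disc through \<open>z\<close> the mapping becomes the Koebe function
      with parameter \<open>q z\<close>, whose coefficients \<open>2 * q\<close>,
      \<open>3 * q\<^sup>2\<close>, \<open>4 * q ^ 3\<close> enter \<open>T\<close>.\<close>
    define q where "q z = z $ j * c / of_real (\<rho> z)" for z
    define T where "T q = (2 * q - 4 * q ^ 3) * ((2 * q)\<^sup>2 - 2 * (3 * q\<^sup>2)\<^sup>2 + 2 * q * (4 * q ^ 3))" for q :: complex
    have bound: "cmod (T (q z)) \<le> C" if z: "z \<in> \<Omega> - E" "z \<noteq> 0" for z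
    proof -
      obtain D where D: "(\<rho> has_derivative D) (at z)" using diff z by blast
      have h: "(\<lambda>\<zeta>. \<zeta> * f (\<zeta> *s (of_real (1 / \<rho> z) *s z))) = (\<lambda>\<zeta>. \<zeta> * (1 / (1 - q z * \<zeta>)\<^sup>2))"
        by (simp add: f_def q_def fun_eq_iff mult_ac)
      note A = coefficients_along_disc(2-4)[OF \<rho> f(1) z(2) D, unfolded h, folded F_def]
      have "A2 \<rho> F z = 2 * q z" "A3 \<rho> F z = 3 * (q z)\<^sup>2" "A4 \<rho> F z = 4 * q z ^ 3"
        using koebe_expansion[of 1 "q z"] koebe_expansion[of 2 "q z"] koebe_expansion[of 3 "q z"]
        unfolding A by (simp_all add: numeral_eq_Suc)
      moreover have "cmod ((A2 \<rho> F z - A4 \<rho> F z) *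
          ((A2 \<rho> F z)\<^sup>2 - 2 * (A3 \<rho> F z)\<^sup>2 + A2 \<rho> F z * A4 \<rho> F z)) \<le> C"
        using C[rule_format, of f F z] f z(1) by (simp add: F_def f_def)
      ultimately show ?thesis by (simp add: T_def)
    qed
    show "84 \<le> C"
    proof (rule ccontr)
      assume "\<not> 84 \<le> C"
      \<comment> \<open>The extremal point itself may lie in \<open>E\<close>; but \<open>U\<close>
        is open and nonempty, hence not a null set, and so contains a point outside
        \<open>E\<close>.\<close>
      define U where "U = (\<Omega> - {0}) \<inter> (\<lambda>z. cmod (T (q z))) -` {C<..}"
      have op: "open (\<Omega> - {0})" using \<Omega>(2) by (intro open_Diff) auto
      have "continuous_on (\<Omega> - {0}) q"
        unfolding q_def using pos(2)
        by (intro continuous_intros continuous_on_subset[OF cont]) auto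
      then have "continuous_on (\<Omega> - {0}) (\<lambda>z. cmod (T (q z)))"
        unfolding T_def by (intro continuous_intros)
      then have "open U"
        unfolding U_def by (intro continuous_open_preimage op) auto
      \<comment> \<open>The factor 1/2 brings \<open>w\<close> into \<Omega> without affecting
        \<open>q\<close>, and \<i> rotates \<open>q\<close> from 1 to \<i>, where the two factors of
        \<open>T\<close> have moduli 6 and 14.\<close>
      moreover have "(\<i> / 2) *s w \<in> U"
      proof -
        have "q ((\<i> / 2) *s w) = \<i>"
          using r(1) by (simp add: q_def hom w c_def norm_mult norm_divide)
        moreover have "T \<i> = 6 * \<i> * (- 14)"
          by (simp add: T_def power3_eq_cube power2_eq_square)
        moreover have "w \<noteq> 0" using w(1) pos(2)[of w] by auto
        ultimately show ?thesis
          using \<open>\<not> 84 \<le> C\<close> w(1) by (simp add: U_def \<Omega>_eq hom norm_mult norm_divide)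
      qed
      ultimately have "\<not> negligible U" using open_not_negligible by blast
      then have "\<not> U \<subseteq> E"
        using negligible_subset[OF exceptional_set_negligible[OF assms(4)]] by blast
      then obtain z where "z \<in> U" "z \<notin> E" by blast
      then show False using bound[of z] by (auto simp: U_def)
    qed
  }
qed

end
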